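(* Put $x=e^{\lambda}+e^{-\lambda}+2$ with $\lambda>0$, and let $W_1^{(g)}(\lambda)$ denote the genus-$g$ term $W_1^{(g)}(x)$ of the one-loop mean of the Laguerre ensemble, expressed through $\lambda$. For $k\in\mathbb Z$ put $$v_k(\lambda)=\Bigl[\frac{e^{\lambda}-1}{e^{\lambda}+1}\Bigr]^{2k+1}.$$ Then for every $g\ge 1$ the function $W_1^{(g)}$ is given by a finite expansion $$W_1^{(g)}(\lambda)=\sum_{k=-3g}^{g}a_k^{(g)}\,v_k(\lambda),$$ while $W_1^{(0)}(\lambda)=\tfrac12+\sum_k a^{(0)}_k v_k(\lambda)$ with $a_k^{(0)}=-\tfrac12\delta_{k,0}$. With the convention $a_k^{(g)}=0$ for $k\notin\{-3g,\dots,g\}$, the coefficients are determined recursively for $g\ge1$: for every $k\neq 0$, $$\begin{aligned}4k\, a_k^{(g)}=&\ \frac{(2k+7)(2k+5)(2k+3)}{32}a_{k+3}^{(g-1)}-\frac{(2k+5)(2k+3)(k+1)}{4}a_{k+2}^{(g-1)}+\frac{3(2k+3)(2k+1)^2}{16}a_{k+1}^{(g-1)}\\&-\frac{(2k+1)k(2k-1)}{4}a_{k}^{(g-1)}+\frac{(2k-1)^2(2k-3)}{32}a_{k-1}^{(g-1)},\end{aligned}$$ and $a_0^{(g)}$ is determined from the asymptotic condition $W_1^{(g)}(\lambda)\to0$ as $\lambda\to+\infty$, that is, from $$\sum_{k=-3g}^{g}a_k^{(g)}=0.$$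
   Context: The Laguerre ensemble: for a positive integer $N$, the eigenvalues $\lambda_1,\dots,\lambda_N\in[0,\infty)$ of a positive-definite Hermitian $N\times N$ matrix $H$ have joint probability density proportional to $\prod_{i<j}(\lambda_i-\lambda_j)^2\,e^{-N\sum_i\lambda_i}$; $\langle\cdot\rangle$ denotes the expectation. The one-loop mean is $W_1(x)=\bigl\langle \mathrm{tr}\frac1{x-H}\bigr\rangle$, understood as the (formal) series $\sum_{n\ge0}\langle \mathrm{tr}\,H^n\rangle x^{-n-1}$ at $x=\infty$. For every $n$ one has $\langle\mathrm{tr}\,H^n\rangle=\sum_{g\ge0}N^{1-2g}c_{n,g}$ (a finite sum, with $c_{n,g}$ independent of $N$), and $W_1^{(g)}(x):=\sum_{n\ge0}c_{n,g}\,x^{-n-1}$, so that $W_1(x)=\sum_{g\ge0}N^{1-2g}W_1^{(g)}(x)$. The series $W_1^{(g)}(x)$ are identified with the analytic functions they define near $x=\infty$ (in particular $W_1^{(0)}(x)=\frac12-\frac12\sqrt{(x-4)/x}$), and these with functions of $\lambda$ via $x=e^\lambda+e^{-\lambda}+2$. $\delta_{k,0}$ is the Kronecker symbol. *)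

theory Defs
  imports "HOL-Analysis.Analysis"
begin

definition laguerre_weight :: "nat \<Rightarrow> (nat \<Rightarrow> real) \<Rightarrow> real" where
  "laguerre_weight N x =
     (if \<forall>i<N. 0 \<le> x i
      then (\<Prod>j<N. \<Prod>i<j. (x i - x j)\<^sup>2) * exp (- real N * (\<Sum>i<N. x i))
      else 0)"

definition laguerre_partition :: "nat \<Rightarrow> real" where
  "laguerre_partition N = (\<integral>x. laguerre_weight N x \<partial>(\<Pi>\<^sub>M i\<in>{..<N}. lborel))"

text \<open>The joint law of the eigenvalues \<open>x 0, \<dots>, x (N - 1)\<close> of the random matrix \<open>H\<close>.\<close>

definition laguerre_ensemble :: "nat \<Rightarrow> (nat \<Rightarrow> real) measure" where
  "laguerre_ensemble N =
     density (\<Pi>\<^sub>M i\<in>{..<N}. lborel)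
       (\<lambda>x. ennreal (laguerre_weight N x / laguerre_partition N))"

text \<open>The expectation of \<open>tr H\<^sup>n\<close>, the trace being the \<open>n\<close>-th power sum of the eigenvalues.\<close>

definition trace_moment :: "nat \<Rightarrow> nat \<Rightarrow> real" where
  "trace_moment N n = (\<integral>x. (\<Sum>i<N. x i ^ n) \<partial>laguerre_ensemble N)"

definition is_genus_expansion :: "(nat \<Rightarrow> nat \<Rightarrow> real) \<Rightarrow> bool" where
  "is_genus_expansion c \<longleftrightarrow>
     (\<forall>n. finite {g. c n g \<noteq> 0}) \<and>
     (\<forall>N\<ge>1. \<forall>n. trace_moment N n =
        (\<Sum>g | c n g \<noteq> 0. real N powi (1 - 2 * int g) * c n g))"

text \<open>
  For each \<open>n\<close> the expansion is a polynomial identity in \<open>1 / N\<^sup>2\<close> holding for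
  infinitely many \<open>N\<close>, so there is at most one such family; it is the array \<open>c\<^sub>n\<^sub>,\<^sub>g\<close>.
\<close>

definition genus_coeff :: "nat \<Rightarrow> nat \<Rightarrow> real" where
  "genus_coeff = (THE c. is_genus_expansion c)"

definition W1_term :: "nat \<Rightarrow> real \<Rightarrow> nat \<Rightarrow> real" where
  "W1_term g x n = genus_coeff n g / x ^ (n + 1)"

definition W1 :: "nat \<Rightarrow> real \<Rightarrow> real" where
  "W1 g x = (\<Sum>n. W1_term g x n)"

definition x_of :: "real \<Rightarrow> real" where
  "x_of l = exp l + exp (- l) + 2"

definition v :: "int \<Rightarrow> real \<Rightarrow> real" where
  "v k l = ((exp l - 1) / (exp l + 1)) powi (2 * k + 1)"

definition index_range :: "nat \<Rightarrow> int set" where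
  "index_range g = {- 3 * int g .. int g}"

definition zero_outside_range :: "(nat \<Rightarrow> int \<Rightarrow> real) \<Rightarrow> bool" where
  "zero_outside_range a \<longleftrightarrow> (\<forall>g k. k \<notin> index_range g \<longrightarrow> a g k = 0)"

text \<open>\<open>a g k\<close> stands for \<open>a\<^sub>k\<^sup>(\<^sup>g\<^sup>)\<close>.\<close>

definition is_W1_expansion :: "(nat \<Rightarrow> int \<Rightarrow> real) \<Rightarrow> bool" where
  "is_W1_expansion a \<longleftrightarrow>
     zero_outside_range a \<and>
     (\<forall>l>0. W1 0 (x_of l) = 1 / 2 + (\<Sum>k\<in>index_range 0. a 0 k * v k l)) \<and>
     (\<forall>g\<ge>1. \<forall>l>0. W1 g (x_of l) = (\<Sum>k\<in>index_range g. a g k * v k l))"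

definition satisfies_recursion :: "(nat \<Rightarrow> int \<Rightarrow> real) \<Rightarrow> bool" where
  "satisfies_recursion a \<longleftrightarrow>
     zero_outside_range a \<and>
     (\<forall>k. a 0 k = - (1 / 2) * (if k = 0 then 1 else 0)) \<and>
     (\<forall>g\<ge>1. \<forall>k. k \<noteq> 0 \<longrightarrow>
        (let r = real_of_int k in
         4 * r * a g k =
             (2*r + 7) * (2*r + 5) * (2*r + 3) / 32 * a (g - 1) (k + 3)
           - (2*r + 5) * (2*r + 3) * (r + 1) / 4 * a (g - 1) (k + 2)
           + 3 * (2*r + 3) * (2*r + 1)\<^sup>2 / 16 * a (g - 1) (k + 1)
           - (2*r + 1) * r * (2*r - 1) / 4 * a (g - 1) k
           + (2*r - 1)\<^sup>2 * (2*r - 3) / 32 * a (g - 1) (k - 1))) \<and>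
     (\<forall>g\<ge>1. (\<Sum>k\<in>index_range g. a g k) = 0)"

end

theory Submission
  imports Defs "HOL-Probability.Probability"
    "HOL-Real_Asymp.Real_Asymp" "Jordan_Normal_Form.Determinant"
begin

text \<open>
  Writing the Vandermonde product as a determinant of Laguerre polynomials \<open>L\<^sub>k\<close> and integrating out
  all but one eigenvalue, the scaled moment \<open>N\<^sup>n \<langle>tr H\<^sup>n\<rangle>\<close> becomes the integral of
  \<open>x\<^sup>n e\<^sup>-\<^sup>x (L\<^sub>0\<^sup>2 + \<dots> + L\<^sub>N\<^sub>-\<^sub>1\<^sup>2)\<close>. The first-order differential system of \<open>L\<^sub>N\<close> and \<open>L\<^sub>N\<^sub>-\<^sub>1\<close> turns this
  into the Haagerup-Thorbjornsen recursion in \<open>n\<close>, which reads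
  \<open>(n + 2) c\<^sub>n\<^sub>+\<^sub>1\<^sub>,\<^sub>g = 2 (2 n + 1) c\<^sub>n\<^sub>,\<^sub>g + (n - 1) n\<^sup>2 c\<^sub>n\<^sub>-\<^sub>1\<^sub>,\<^sub>g\<^sub>-\<^sub>1\<close> in terms of the genus coefficients.
  In the variable \<open>u = (1 - 4 / x)\<^sup>1\<^sup>/\<^sup>2 = (e\<^sup>\<lambda> - 1) / (e\<^sup>\<lambda> + 1)\<close> this recursion acts on odd Laurent polynomials
  by the stated one for the \<open>a\<^sub>k\<close>. Integrating it would produce a logarithm if the right-hand
  side had a component at \<open>k = 0\<close>; a hidden skew-symmetry of the recursion rules this out.
\<close>

subsection \<open>The recursion\<close>

text \<open>The recursion is written as a banded matrix because both its skew-symmetry and its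
  action on the \<open>v k\<close> interchange rows and columns.\<close>

definition rec_entry :: "int \<Rightarrow> int \<Rightarrow> real" where
  "rec_entry k j = (let r = real_of_int k in
     (if j = k + 3 then (2*r + 7) * (2*r + 5) * (2*r + 3) / 32 else 0)
     - (if j = k + 2 then (2*r + 5) * (2*r + 3) * (r + 1) / 4 else 0)
     + (if j = k + 1 then 3 * (2*r + 3) * (2*r + 1)\<^sup>2 / 16 else 0)
     - (if j = k then (2*r + 1) * r * (2*r - 1) / 4 else 0)
     + (if j = k - 1 then (2*r - 1)\<^sup>2 * (2*r - 3) / 32 else 0))"

definition rec_rhs :: "(int \<Rightarrow> real) \<Rightarrow> int \<Rightarrow> real" where
  "rec_rhs b k = (let r = real_of_int k in
             (2*r + 7) * (2*r + 5) * (2*r + 3) / 32 * b (k + 3)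
           - (2*r + 5) * (2*r + 3) * (r + 1) / 4 * b (k + 2)
           + 3 * (2*r + 3) * (2*r + 1)\<^sup>2 / 16 * b (k + 1)
           - (2*r + 1) * r * (2*r - 1) / 4 * b k
           + (2*r - 1)\<^sup>2 * (2*r - 3) / 32 * b (k - 1))"

lemma sum_rec_entry:
  assumes "finite S" and "\<And>j. j \<notin> S \<Longrightarrow> b j = 0"
  shows "(\<Sum>j\<in>S. rec_entry k j * b j) = rec_rhs b k"
proof -
  have delta: "(\<Sum>j\<in>S. (if j = i then c else 0) * b j) = c * b i" for i c
  proof -
    have "(\<Sum>j\<in>S. (if j = i then c else 0) * b j) = (\<Sum>j\<in>S. if j = i then c * b j else 0)"
      by (rule sum.cong) auto
    then show ?thesis using assms by (auto simp: sum.delta)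
  qed
  show ?thesis
    unfolding rec_entry_def rec_rhs_def Let_def
    by (simp only: distrib_right left_diff_distrib sum.distrib sum_subtractf delta)
qed

text \<open>The support condition involves only \<open>i + j\<close>, which must lie between -1 and
  3. On these five lines the left side factors as
  \<open>(4 i^2 - 1) (4 j^2 - 1) (j - i) / 32\<close> times 1, -4, 6, -4, 1, which is visibly
  antisymmetric.\<close>

lemma rec_entry_skew:
  "(4 * (real_of_int i)\<^sup>2 - 1) * rec_entry (- i) j = - ((4 * (real_of_int j)\<^sup>2 - 1) * rec_entry (- j) i)"
proof -
  consider "j = - i + 3" | "j = - i + 2" | "j = - i + 1" | "j = - i" | "j = - i - 1"
    | "j \<noteq> - i + 3" "j \<noteq> - i + 2" "j \<noteq> - i + 1" "j \<noteq> - i" "j \<noteq> - i - 1" by blast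
  then show ?thesis
    by cases (simp_all add: rec_entry_def Let_def, (simp add: field_simps power2_eq_square)+)
qed

text \<open>The entry at \<open>k = 0\<close>, which the recursion leaves open, is chosen to make
  all entries of the same genus sum to zero; this encodes the decay of \<open>W1\<close> at
  infinity.\<close>

fun expansion_coeff :: "nat \<Rightarrow> int \<Rightarrow> real" where
  "expansion_coeff 0 k = (if k = 0 then - (1 / 2) else 0)"
| "expansion_coeff (Suc g) k =
     (if k = 0 then - (\<Sum>j\<in>index_range (Suc g) - {0}. rec_rhs (expansion_coeff g) j / (4 * j))
      else rec_rhs (expansion_coeff g) k / (4 * k))"

text \<open>Row \<open>k\<close> reads the previous genus at \<open>k - 1\<close> up to
  \<open>k + 3\<close>, so each step extends the support by three downwards and by one
  upwards.\<close>

lemma expansion_coeff_outside: "k \<notin> index_range g \<Longrightarrow> expansion_coeff g k = 0"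
proof (induction g arbitrary: k)
  case 0
  then show ?case by (auto simp: index_range_def)
next
  case (Suc g)
  have z: "expansion_coeff g j = 0" if "j \<in> {k + 3, k + 2, k + 1, k, k - 1}" for j
    using Suc.prems that by (intro Suc.IH) (auto simp: index_range_def)
  have "k \<noteq> 0" using Suc.prems by (auto simp: index_range_def)
  then show ?case by (simp add: rec_rhs_def z)
qed

lemma finite_index_range [simp]: "finite (index_range g)"
  by (simp add: index_range_def)

lemma zero_in_index_range [simp]: "0 \<in> index_range g"
  by (simp add: index_range_def)

lemma sum_expansion_coeff: "(\<Sum>k\<in>index_range (Suc g). expansion_coeff (Suc g) k) = 0"
proof -
  have "(\<Sum>k\<in>index_range (Suc g). expansion_coeff (Suc g) k) =
        expansion_coeff (Suc g) 0 + (\<Sum>k\<in>index_range (Suc g) - {0}. expansion_coeff (Suc g) k)"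
    by (rule sum.remove) auto
  also have "(\<Sum>k\<in>index_range (Suc g) - {0}. expansion_coeff (Suc g) k) =
      (\<Sum>j\<in>index_range (Suc g) - {0}. rec_rhs (expansion_coeff g) j / (4 * j))"
    by (rule sum.cong) auto
  finally show ?thesis by simp
qed

lemma expansion_coeff_rec_nonzero:
  "k \<noteq> 0 \<Longrightarrow> 4 * real_of_int k * expansion_coeff (Suc g) k = rec_rhs (expansion_coeff g) k"
  by simp

text \<open>
  The recursion also holds at \<open>k = 0\<close>, where it is a constraint on the previous coefficients:
  with the weights \<open>4 k\<^sup>2 - 1\<close> the operators on both sides become skew-symmetric under
  \<open>k \<mapsto> - k\<close>, so pairing the whole formal series in the genus with its own recursion gives zero,
  and the only term which is not known to vanish is the one with \<open>k = 0\<close> in the top genus.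
\<close>
lemma rec_rhs_expansion_coeff_0: "rec_rhs (expansion_coeff g) 0 = 0"
proof (induction g rule: less_induct)
  case (less g)
  \<comment> \<open>The set is symmetric, so that negation permutes it, and it contains the supports
    of all genera up to \<open>Suc g\<close>.\<close>
  define S where "S = {- (3 * int g + 3) .. 3 * int g + 3}"
  define a where "a = expansion_coeff"
  define w where "w i = 4 * (real_of_int i)\<^sup>2 - 1" for i
  have [simp]: "finite S" by (simp add: S_def)
  have out: "a h j = 0" if "j \<notin> S" "h \<le> g" for h j
    unfolding a_def using that by (intro expansion_coeff_outside) (auto simp: S_def index_range_def)
  define B where "B b c = (\<Sum>i\<in>S. \<Sum>j\<in>S. b i * (w i * rec_entry (- i) j) * c j)" for b c :: "int \<Rightarrow> real"
  have B_skew: "B b c = - B c b" for b c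
  proof -
    have "B b c = (\<Sum>j\<in>S. \<Sum>i\<in>S. b i * (w i * rec_entry (- i) j) * c j)"
      unfolding B_def by (rule sum.swap)
    also have "\<dots> = - B c b"
      unfolding B_def sum_negf[symmetric]
    proof (intro sum.cong refl)
      fix j i
      have "w i * rec_entry (- i) j = - (w j * rec_entry (- j) i)"
        unfolding w_def by (rule rec_entry_skew)
      then show "b i * (w i * rec_entry (- i) j) * c j = - (c j * (w j * rec_entry (- j) i) * b i)"
        by (simp only: mult_minus_left mult_minus_right mult.commute mult.left_commute minus_minus)
    qed
    finally show ?thesis .
  qed
  \<comment> \<open>Reversing the convolution swaps the two arguments of the skew form
    \<open>B\<close>, so the sum equals its own negative. The form \<open>D\<close>, built from the
    left side of the recursion, is treated in the same way.\<close>
  have "(\<Sum>h\<le>g. B (a h) (a (g - h))) = (\<Sum>h\<le>g. B (a (g - h)) (a h))"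
    by (rule sum.reindex_bij_witness[of _ "\<lambda>h. g - h" "\<lambda>h. g - h"]) auto
  also have "\<dots> = - (\<Sum>h\<le>g. B (a h) (a (g - h)))"
    unfolding sum_negf[symmetric] by (intro sum.cong refl B_skew)
  finally have B_zero: "(\<Sum>h\<le>g. B (a h) (a (g - h))) = 0" by simp
  have B_eq: "B (a h) (a (g - h)) = (\<Sum>i\<in>S. a h i * w i * rec_rhs (a (g - h)) (- i))" if "h \<le> g" for h
    unfolding B_def
    by (subst sum_rec_entry[of S, symmetric])
      (auto simp: out sum_distrib_left mult.assoc intro!: sum.cong)
  define D where "D b c = (\<Sum>i\<in>S. b i * (w i * (- 4 * real_of_int i)) * c (- i))" for b c :: "int \<Rightarrow> real"
  have D_skew: "D b c = - D c b" for b c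
    unfolding D_def sum_negf[symmetric]
    by (rule sum.reindex_bij_witness[of _ uminus uminus]) (auto simp: S_def w_def)
  have "(\<Sum>h\<le>Suc g. D (a h) (a (Suc g - h))) = (\<Sum>h\<le>Suc g. D (a (Suc g - h)) (a h))"
    by (rule sum.reindex_bij_witness[of _ "\<lambda>h. Suc g - h" "\<lambda>h. Suc g - h"]) auto
  also have "\<dots> = - (\<Sum>h\<le>Suc g. D (a h) (a (Suc g - h)))"
    unfolding sum_negf[symmetric] by (intro sum.cong refl D_skew)
  finally have D_zero: "(\<Sum>h\<le>Suc g. D (a h) (a (Suc g - h))) = 0" by simp
  \<comment> \<open>Genus 0 is supported at index 0, where the factor \<open>i\<close> vanishes.
    This removes the term with \<open>h = Suc g\<close>, leaving the same range of \<open>h\<close>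
    as in the sum for \<open>B\<close>.\<close>
  have "D (a (Suc g)) (a 0) = 0"
    unfolding D_def by (rule sum.neutral) (auto simp: a_def)
  with D_zero have D_zero': "(\<Sum>h\<le>g. D (a h) (a (Suc g - h))) = 0" by simp
  \<comment> \<open>The defect of the recursion at index \<open>- i\<close> in genus
    \<open>Suc g - h\<close>. It vanishes for \<open>i \<noteq> 0\<close> by construction and for
    \<open>i = 0\<close>, \<open>h > 0\<close> by the induction hypothesis, so that only
    \<open>R 0 0\<close> survives in the difference of the two pairings.\<close>
  define R where "R h i = rec_rhs (a (g - h)) (- i) - (- 4 * real_of_int i) * a (Suc g - h) (- i)" for h i
  have R_zero: "R h i = 0" if "h \<le> g" "i \<noteq> 0 \<or> h \<noteq> 0" for h i
  proof (cases "i = 0")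
    case False
    with that show ?thesis
      using expansion_coeff_rec_nonzero[of "- i" "g - h"] by (simp add: R_def a_def Suc_diff_le)
  next
    case True
    with that less.IH[of "g - h"] show ?thesis by (simp add: R_def a_def)
  qed
  have "0 = (\<Sum>h\<le>g. B (a h) (a (g - h)) - D (a h) (a (Suc g - h)))"
    by (simp add: sum_subtractf B_zero D_zero')
  also have "\<dots> = (\<Sum>h\<le>g. \<Sum>i\<in>S. a h i * w i * R h i)"
    by (intro sum.cong refl)
      (simp add: B_eq D_def R_def sum_subtractf[symmetric] algebra_simps)
  also have "\<dots> = (\<Sum>h\<le>g. if h = 0 then \<Sum>i\<in>S. a h i * w i * R h i else 0)"
    by (intro sum.cong refl) (auto simp: R_zero)
  also have "\<dots> = (\<Sum>i\<in>S. a 0 i * w i * R 0 i)"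
    by (simp add: sum.delta)
  also have "\<dots> = (\<Sum>i\<in>S. if i = 0 then a 0 i * w i * R 0 i else 0)"
    by (intro sum.cong refl) (auto simp: R_zero)
  also have "\<dots> = a 0 0 * w 0 * R 0 0"
    by (simp add: sum.delta S_def)
  also have "\<dots> = rec_rhs (expansion_coeff g) 0 / 2"
    by (simp add: a_def w_def R_def)
  finally show ?case by simp
qed

lemma expansion_coeff_rec:
  "4 * real_of_int k * expansion_coeff (Suc g) k = rec_rhs (expansion_coeff g) k"
  by (cases "k = 0") (simp_all add: rec_rhs_expansion_coeff_0)

declare expansion_coeff.simps(2) [simp del]

subsection \<open>Power series of the half-integer powers\<close>

text \<open>
  As \<open>((e\<^sup>\<lambda> - 1) / (e\<^sup>\<lambda> + 1))\<^sup>2 = 1 - 4 / x\<close>, the number \<open>sqrt_coeff k m\<close> is the coefficient of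
  \<open>x\<^sup>-\<^sup>m\<close> in \<open>v k\<close>.
\<close>
definition sqrt_coeff :: "int \<Rightarrow> nat \<Rightarrow> real" where
  "sqrt_coeff k m = ((real_of_int k + 1/2) gchoose m) * (- 4) ^ m"

lemma sqrt_coeff_Suc:
  "real (Suc m) * sqrt_coeff k (Suc m) = (4 * real m - 4 * real_of_int k - 2) * sqrt_coeff k m"
proof -
  define a where "a = real_of_int k + 1/2"
  have "real (Suc m) * (a gchoose Suc m) = (a - real m) * (a gchoose m)"
    using gbinomial_mult_1[of a m] by (simp add: algebra_simps)
  then have "real (Suc m) * (a gchoose Suc m) * (- 4) ^ Suc m = (a - real m) * (a gchoose m) * (- 4) ^ Suc m"
    by simp
  then show ?thesis
    unfolding sqrt_coeff_def a_def[symmetric] by (simp add: a_def algebra_simps)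
qed

lemma sqrt_coeff_add_1:
  "(2 * real_of_int k + 3 - 2 * real m) * sqrt_coeff (k + 1) m = (2 * real_of_int k + 3) * sqrt_coeff k m"
proof -
  have "((a + 1) - real m) * ((a + 1) gchoose m) = (a + 1) * (a gchoose m)" for a :: real
    by (rule gbinomial_absorb_comp[of "a + 1" m, simplified])
  then have "(real_of_int k + 1/2 + 1 - real m) * ((real_of_int k + 1/2 + 1) gchoose m) * (2 * (- 4) ^ m) =
      (real_of_int k + 1/2 + 1) * ((real_of_int k + 1/2) gchoose m) * (2 * (- 4) ^ m)"
    by (simp only:)
  then show ?thesis
    by (simp add: sqrt_coeff_def algebra_simps)
qed

text \<open>Column \<open>j\<close> of the matrix combines the series of \<open>v (j - 3)\<close> up
  to \<open>v (j + 1)\<close>. By \<open>sqrt_coeff_add_1\<close> their coefficients at a fixed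
  \<open>n\<close> are rational multiples of one another, so a polynomial identity remains. The
  denominators are odd integers and hence nonzero.\<close>

lemma rec_entry_sqrt_coeff:
  assumes "finite S" "{j - 3..j + 1} \<subseteq> S"
  shows "2 * (2 * real_of_int j + 3 - 2 * real n) * (\<Sum>k\<in>S. rec_entry k j * sqrt_coeff k n)
       = real n * (real n - 1)\<^sup>2 * (real n - 2) * sqrt_coeff j n"
proof -
  define r where "r = real_of_int j"
  define q where "q = real n"
  have ne: "2 * real_of_int i + 3 - 2 * q \<noteq> 0" for i :: int
  proof
    assume "2 * real_of_int i + 3 - 2 * q = 0"
    then have "real_of_int (2 * i + 3 - 2 * int n) = 0" by (simp add: q_def)
    then have "2 * i + 3 - 2 * int n = 0" by (simp only: of_int_eq_0_iff)
    then show False by presburger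
  qed
  have delta: "(\<Sum>k\<in>S. (if P k then f k else 0) * sqrt_coeff k n) = f i * sqrt_coeff i n"
    if "\<And>k. P k \<longleftrightarrow> k = i" "i \<in> S" for i P and f :: "int \<Rightarrow> real"
  proof -
    have "(\<Sum>k\<in>S. (if P k then f k else 0) * sqrt_coeff k n)
        = (\<Sum>k\<in>S. if k = i then f k * sqrt_coeff k n else 0)"
      by (rule sum.cong) (auto simp: that)
    then show ?thesis using assms(1) that(2) by (simp add: sum.delta)
  qed
  have mem: "j - 3 \<in> S" "j - 2 \<in> S" "j - 1 \<in> S" "j \<in> S" "j + 1 \<in> S" using assms(2) by auto
  have deltas:
    "(\<Sum>k\<in>S. (if j = k + 3 then f k else 0) * sqrt_coeff k n) = f (j - 3) * sqrt_coeff (j - 3) n"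
    "(\<Sum>k\<in>S. (if j = k + 2 then f k else 0) * sqrt_coeff k n) = f (j - 2) * sqrt_coeff (j - 2) n"
    "(\<Sum>k\<in>S. (if j = k + 1 then f k else 0) * sqrt_coeff k n) = f (j - 1) * sqrt_coeff (j - 1) n"
    "(\<Sum>k\<in>S. (if j = k then f k else 0) * sqrt_coeff k n) = f j * sqrt_coeff j n"
    "(\<Sum>k\<in>S. (if j = k - 1 then f k else 0) * sqrt_coeff k n) = f (j + 1) * sqrt_coeff (j + 1) n"
    for f :: "int \<Rightarrow> real"
    by (rule delta; use mem in auto)+
  have sum_eq: "(\<Sum>k\<in>S. rec_entry k j * sqrt_coeff k n) =
      (2*r + 1) * (2*r - 1) * (2*r - 3) / 32 * sqrt_coeff (j - 3) n
    - (2*r + 1) * (2*r - 1) * (r - 1) / 4 * sqrt_coeff (j - 2) n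
    + 3 * (2*r + 1) * (2*r - 1)\<^sup>2 / 16 * sqrt_coeff (j - 1) n
    - (2*r + 1) * r * (2*r - 1) / 4 * sqrt_coeff j n
    + (2*r + 1)\<^sup>2 * (2*r - 1) / 32 * sqrt_coeff (j + 1) n"
    unfolding rec_entry_def Let_def
      distrib_right[of _ _ "sqrt_coeff k n" for k]
      left_diff_distrib[of _ _ "sqrt_coeff k n" for k] sum.distrib sum_subtractf deltas
    by (simp add: r_def add.commute)
  define p where "p = 2 * r - 2 * q"
  have p: "p - 3 \<noteq> 0" "p - 1 \<noteq> 0" "p + 1 \<noteq> 0" "p + 3 \<noteq> 0"
    using ne[of "j - 3"] ne[of "j - 2"] ne[of "j - 1"] ne[of j] by (simp_all add: p_def r_def)
  \<comment> \<open>Dividing by all denominators of the chain at once makes each of the five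
    neighbouring coefficients a polynomial multiple of \<open>T\<close>.\<close>
  define T where "T = sqrt_coeff (j - 3) n / ((p - 3) * (p - 1) * (p + 1) * (p + 3))"
  have s3: "sqrt_coeff (j - 3) n = (p - 3) * (p - 1) * (p + 1) * (p + 3) * T"
    using p by (simp add: T_def)
  have "(p - 3) * sqrt_coeff (j - 2) n = (p - 3) * ((2*r - 3) * (p - 1) * (p + 1) * (p + 3) * T)"
    using sqrt_coeff_add_1[of "j - 3" n] by (simp add: s3 p_def r_def q_def algebra_simps)
  then have s2: "sqrt_coeff (j - 2) n = (2*r - 3) * (p - 1) * (p + 1) * (p + 3) * T"
    using p(1) by simp
  have "(p - 1) * sqrt_coeff (j - 1) n = (p - 1) * ((2*r - 3) * (2*r - 1) * (p + 1) * (p + 3) * T)"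
    using sqrt_coeff_add_1[of "j - 2" n] by (simp add: s2 p_def r_def q_def algebra_simps)
  then have s1: "sqrt_coeff (j - 1) n = (2*r - 3) * (2*r - 1) * (p + 1) * (p + 3) * T"
    using p(2) by simp
  have "(p + 1) * sqrt_coeff j n = (p + 1) * ((2*r - 3) * (2*r - 1) * (2*r + 1) * (p + 3) * T)"
    using sqrt_coeff_add_1[of "j - 1" n] by (simp add: s1 p_def r_def q_def algebra_simps)
  then have s0: "sqrt_coeff j n = (2*r - 3) * (2*r - 1) * (2*r + 1) * (p + 3) * T"
    using p(3) by simp
  have "(p + 3) * sqrt_coeff (j + 1) n = (p + 3) * ((2*r - 3) * (2*r - 1) * (2*r + 1) * (2*r + 3) * T)"
    using sqrt_coeff_add_1[of j n] by (simp add: s0 p_def r_def q_def algebra_simps)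
  then have s': "sqrt_coeff (j + 1) n = (2*r - 3) * (2*r - 1) * (2*r + 1) * (2*r + 3) * T"
    using p(4) by simp
  show ?thesis
    unfolding sum_eq s3 s2 s1 s0 s' p_def r_def[symmetric] q_def[symmetric]
    by (simp add: field_simps power2_eq_square)
qed

text \<open>One step of \<open>sqrt_coeff_Suc\<close> produces exactly the odd factor on the left of
  the previous lemma, up to sign, and cancels it. The result is the inhomogeneous term of the moment
  recursion.\<close>

lemma rec_entry_sqrt_coeff_Suc:
  assumes "finite S" "{j - 3..j + 1} \<subseteq> S"
  shows "(\<Sum>k\<in>S. rec_entry k j * sqrt_coeff k (Suc m)) = - ((real m - 1) * (real m)\<^sup>2 * sqrt_coeff j m)"
proof -
  define c where "c = 2 * (2 * real_of_int j + 1 - 2 * real m)"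
  have "c \<noteq> 0"
  proof
    assume "c = 0"
    then have "real_of_int (2 * j + 1 - 2 * int m) = 0" by (simp add: c_def)
    then have "2 * j + 1 - 2 * int m = 0" by (simp only: of_int_eq_0_iff)
    then show False by presburger
  qed
  have "c * (\<Sum>k\<in>S. rec_entry k j * sqrt_coeff k (Suc m))
      = (real m - 1) * (real m)\<^sup>2 * (real (Suc m) * sqrt_coeff j (Suc m))"
    using rec_entry_sqrt_coeff[OF assms, of "Suc m"] by (simp add: c_def algebra_simps)
  also have "\<dots> = c * (- ((real m - 1) * (real m)\<^sup>2 * sqrt_coeff j m))"
    unfolding sqrt_coeff_Suc by (simp add: c_def algebra_simps)
  finally show ?thesis using \<open>c \<noteq> 0\<close> mult_left_cancel by blast
qed

text \<open>Transposition of the matrix against an arbitrary sequence \<open>s\<close>. The sum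
  includes \<open>k = 0\<close>, so the argument depends on the vanishing of \<open>rec_rhs\<close>
  there.\<close>

lemma sum_rec_rhs:
  assumes "\<And>j. j \<in> index_range g \<Longrightarrow> (\<Sum>k\<in>index_range (Suc g). rec_entry k j * s k) = f j"
  shows "(\<Sum>k\<in>index_range (Suc g). 4 * real_of_int k * expansion_coeff (Suc g) k * s k)
    = (\<Sum>j\<in>index_range g. expansion_coeff g j * f j)"
proof -
  let ?a = expansion_coeff and ?S = "index_range (Suc g)" and ?T = "index_range g"
  have "(\<Sum>k\<in>?S. 4 * real_of_int k * expansion_coeff (Suc g) k * s k)
      = (\<Sum>k\<in>?S. (\<Sum>j\<in>?T. rec_entry k j * ?a g j) * s k)"
    unfolding expansion_coeff_rec
    by (intro sum.cong refl) (subst sum_rec_entry, auto simp: expansion_coeff_outside)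
  also have "\<dots> = (\<Sum>j\<in>?T. \<Sum>k\<in>?S. rec_entry k j * ?a g j * s k)"
    unfolding sum_distrib_right by (rule sum.swap)
  also have "\<dots> = (\<Sum>j\<in>?T. ?a g j * (\<Sum>k\<in>?S. rec_entry k j * s k))"
    by (simp add: sum_distrib_left mult_ac)
  finally show ?thesis using assms by simp
qed

text \<open>The coefficient of \<open>x^(-n-1)\<close> in the proposed expansion, later identified
  with \<open>genus_coeff n g\<close>.\<close>

definition moment_coeff :: "nat \<Rightarrow> nat \<Rightarrow> real" where
  "moment_coeff n g = (\<Sum>k\<in>index_range g. expansion_coeff g k * sqrt_coeff k (Suc n))"

text \<open>The homogeneous part of the moment recursion is diagonal: on the coefficients of
  \<open>v k\<close> it is multiplication by \<open>- 4 k\<close> at index \<open>m + 1\<close>.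
  These factors are the left side of the recursion for the expansion coefficients, and
  \<open>sum_rec_rhs\<close> passes to the lower genus.\<close>

lemma expansion_sqrt_coeff_Suc:
  "real (m + 2) * (\<Sum>k\<in>index_range (Suc g). expansion_coeff (Suc g) k * sqrt_coeff k (m + 2)) =
     2 * (2 * real m + 1) * (\<Sum>k\<in>index_range (Suc g). expansion_coeff (Suc g) k * sqrt_coeff k (m + 1)) +
     (real m - 1) * (real m)\<^sup>2 * (\<Sum>k\<in>index_range g. expansion_coeff g k * sqrt_coeff k m)"
proof -
  let ?a = expansion_coeff and ?S = "index_range (Suc g)" and ?T = "index_range g"
  have "real (m + 2) * (\<Sum>k\<in>?S. ?a (Suc g) k * sqrt_coeff k (m + 2))
      - 2 * (2 * real m + 1) * (\<Sum>k\<in>?S. ?a (Suc g) k * sqrt_coeff k (m + 1))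
      = (\<Sum>k\<in>?S. ?a (Suc g) k * (real (m + 2) * sqrt_coeff k (m + 2)
            - 2 * (2 * real m + 1) * sqrt_coeff k (m + 1)))"
    by (simp add: sum_distrib_left sum_subtractf right_diff_distrib mult.left_commute)
  also have "\<dots> = (\<Sum>k\<in>?S. - (4 * real_of_int k * ?a (Suc g) k) * sqrt_coeff k (Suc m))"
  proof (intro sum.cong refl)
    fix k
    have "real (m + 2) * sqrt_coeff k (m + 2) - 2 * (2 * real m + 1) * sqrt_coeff k (m + 1)
        = - (4 * real_of_int k * sqrt_coeff k (Suc m))"
      using sqrt_coeff_Suc[of "Suc m" k] by (simp add: algebra_simps)
    then show "?a (Suc g) k * (real (m + 2) * sqrt_coeff k (m + 2) - 2 * (2 * real m + 1) * sqrt_coeff k (m + 1))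
        = - (4 * real_of_int k * ?a (Suc g) k) * sqrt_coeff k (Suc m)"
      by simp
  qed
  also have "\<dots> = - (\<Sum>j\<in>?T. ?a g j * - ((real m - 1) * (real m)\<^sup>2 * sqrt_coeff j m))"
    unfolding mult_minus_left[of _ "sqrt_coeff k (Suc m)" for k] sum_negf
  proof (subst sum_rec_rhs)
    fix j assume "j \<in> ?T"
    then have "{j - 3..j + 1} \<subseteq> ?S" by (auto simp: index_range_def)
    then show "(\<Sum>k\<in>?S. rec_entry k j * sqrt_coeff k (Suc m)) = - ((real m - 1) * (real m)\<^sup>2 * sqrt_coeff j m)"
      by (simp add: rec_entry_sqrt_coeff_Suc)
  qed (rule refl)
  also have "\<dots> = (real m - 1) * (real m)\<^sup>2 * (\<Sum>k\<in>?T. ?a g k * sqrt_coeff k m)"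
    by (simp add: sum_distrib_left sum_negf mult_ac)
  finally show ?thesis by simp
qed

text \<open>The first coefficient of \<open>v k\<close> is \<open>- 4 k - 2\<close>. In positive
  genus the constant part vanishes since the expansion coefficients sum to zero, and the part linear
  in \<open>k\<close> vanishes by the transposed recursion at \<open>n = 0\<close>.\<close>

lemma moment_coeff_0: "moment_coeff 0 g = (if g = 0 then 1 else 0)"
proof (cases g)
  case 0
  then show ?thesis by (simp add: moment_coeff_def index_range_def sqrt_coeff_def)
next
  case (Suc h)
  have s0: "sqrt_coeff k 0 = 1" for k by (simp add: sqrt_coeff_def)
  have s1: "sqrt_coeff k (Suc 0) = - 4 * real_of_int k - 2" for k
    using sqrt_coeff_Suc[of 0 k] by (simp add: s0)
  have "moment_coeff 0 g = (\<Sum>k\<in>index_range (Suc h). - (4 * real_of_int k * expansion_coeff (Suc h) k * sqrt_coeff k 0)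
          - 2 * expansion_coeff (Suc h) k)"
    unfolding moment_coeff_def Suc by (intro sum.cong refl) (simp add: s0 s1 algebra_simps)
  also have "\<dots> = - (\<Sum>k\<in>index_range (Suc h). 4 * real_of_int k * expansion_coeff (Suc h) k * sqrt_coeff k 0)"
    unfolding sum_subtractf sum_negf sum_distrib_left[symmetric] sum_expansion_coeff by simp
  also have "\<dots> = - (\<Sum>j\<in>index_range h. expansion_coeff h j * 0)"
  proof (subst sum_rec_rhs)
    fix j assume "j \<in> index_range h"
    then have "{j - 3..j + 1} \<subseteq> index_range (Suc h)" by (auto simp: index_range_def)
    from rec_entry_sqrt_coeff[OF _ this, of 0]
    have "4 * real_of_int j + 6 = 0 \<or> (\<Sum>k\<in>index_range (Suc h). rec_entry k j * sqrt_coeff k 0) = 0"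
      by simp
    moreover have "real_of_int (2 * j + 3) \<noteq> 0"
      unfolding of_int_eq_0_iff by presburger
    ultimately show "(\<Sum>k\<in>index_range (Suc h). rec_entry k j * sqrt_coeff k 0) = 0" by simp
  qed (rule refl)
  also have "\<dots> = 0" by simp
  finally show ?thesis using Suc by simp
qed

text \<open>In genus 0 the moments are the Catalan numbers, and this is their two-term
  recursion.\<close>

lemma moment_coeff_Suc_0:
  "(real n + 2) * moment_coeff (Suc n) 0 = 2 * (2 * real n + 1) * moment_coeff n 0"
  using sqrt_coeff_Suc[of "Suc n" 0] by (simp add: moment_coeff_def index_range_def algebra_simps)

lemma moment_coeff_1: "moment_coeff (Suc 0) (Suc g) = moment_coeff 0 (Suc g)"
  using expansion_sqrt_coeff_Suc[of 0 g] by (simp add: moment_coeff_def numeral_2_eq_2)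

lemma moment_coeff_Suc_Suc:
  "(real n + 3) * moment_coeff (n + 2) (Suc g) =
     2 * (2 * real n + 3) * moment_coeff (n + 1) (Suc g) + real n * (real n + 1)\<^sup>2 * moment_coeff n g"
  using expansion_sqrt_coeff_Suc[of "Suc n" g]
  by (simp add: moment_coeff_def numeral_2_eq_2 numeral_3_eq_3 algebra_simps)

subsection \<open>Laguerre polynomials\<close>

text \<open>The functional \<open>p \<mapsto> \<integral>\<^sub>0\<^sup>\<infinity> p(x) e\<^sup>-\<^sup>x dx\<close>, for which \<open>exp_moment_pderiv\<close> is integration by parts.\<close>
definition exp_moment :: "real poly \<Rightarrow> real" where
  "exp_moment p = (\<Sum>i\<le>degree p. coeff p i * fact i)"

lemma exp_moment_eq: "degree p \<le> n \<Longrightarrow> exp_moment p = (\<Sum>i\<le>n. coeff p i * fact i)"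
  unfolding exp_moment_def by (rule sum.mono_neutral_left) (auto simp: coeff_eq_0)

lemma exp_moment_add: "exp_moment (p + q) = exp_moment p + exp_moment q"
proof -
  define n where "n = max (degree p) (degree q)"
  have "degree (p + q) \<le> n" "degree p \<le> n" "degree q \<le> n"
    by (auto simp: n_def degree_add_le)
  then show ?thesis by (simp add: exp_moment_eq algebra_simps sum.distrib)
qed

lemma exp_moment_smult: "exp_moment (Polynomial.smult c p) = c * exp_moment p"
  by (simp add: exp_moment_eq[OF degree_smult_le] exp_moment_def sum_distrib_left mult.assoc)

lemma exp_moment_minus: "exp_moment (- p) = - exp_moment p"
  by (simp add: exp_moment_def sum_negf)

lemma exp_moment_diff: "exp_moment (p - q) = exp_moment p - exp_moment q"
  using exp_moment_add[of p "- q"] by (simp add: exp_moment_minus)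

lemma exp_moment_of_nat: "exp_moment (of_nat n * p) = real n * exp_moment p"
  by (simp add: of_nat_poly exp_moment_smult)

lemma exp_moment_pderiv: "exp_moment (pderiv p) = exp_moment p - coeff p 0"
proof (cases "degree p")
  case 0
  then obtain c where "p = [:c:]" by (metis degree_eq_zeroE)
  then show ?thesis by (simp add: exp_moment_def)
next
  case (Suc n)
  have "degree (pderiv p) \<le> n" by (simp add: degree_pderiv Suc)
  then have "exp_moment (pderiv p) = (\<Sum>i\<le>n. coeff p (Suc i) * fact (Suc i))"
    by (simp add: exp_moment_eq coeff_pderiv algebra_simps)
  also have "\<dots> = exp_moment p - coeff p 0"
    by (simp add: exp_moment_def Suc sum.atMost_Suc_shift del: sum.atMost_Suc)
  finally show ?thesis .
qed

abbreviation (input) X :: "real poly" where "X \<equiv> [:0, 1:]"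

lemma exp_moment_pderiv_X_mult: "exp_moment (pderiv (X * p)) = exp_moment (X * p)"
  by (simp add: exp_moment_pderiv)

text \<open>Integration by parts; the factor \<open>x^(n+1)\<close> removes the boundary term at
  0.\<close>

lemma exp_moment_X_power_pderiv:
  "exp_moment (X ^ n * (X * pderiv f)) = exp_moment (X ^ Suc n * f) - real (Suc n) * exp_moment (X ^ n * f)"
proof -
  have "pderiv (X * (X ^ n * f)) = of_nat (Suc n) * (X ^ n * f) + X ^ n * (X * pderiv f)"
    unfolding mult.assoc[symmetric] power_Suc[symmetric]
    by (simp add: pderiv_mult pderiv_power_Suc pderiv_pCons of_nat_poly del: power_Suc) (simp add: algebra_simps)
  then have "exp_moment (X * (X ^ n * f)) = exp_moment (of_nat (Suc n) * (X ^ n * f)) + exp_moment (X ^ n * (X * pderiv f))"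
    using exp_moment_pderiv_X_mult[of "X ^ n * f"] by (simp only: exp_moment_add)
  then show ?thesis unfolding exp_moment_of_nat by (simp add: mult.assoc)
qed

definition laguerre :: "nat \<Rightarrow> real poly" where
  "laguerre n = (\<Sum>i\<le>n. monom ((- 1) ^ i * real (n choose i) / fact i) i)"

lemma coeff_laguerre: "coeff (laguerre n) i = (- 1) ^ i * real (n choose i) / fact i"
  by (simp add: laguerre_def coeff_sum sum.delta)

lemma laguerre_0 [simp]: "laguerre 0 = 1"
  by (simp add: laguerre_def monom_0 one_pCons)

lemma coeff_pderiv_laguerre: "coeff (pderiv (laguerre n)) i = - ((- 1) ^ i * real (n choose Suc i) / fact i)"
proof -
  have "(1 + real i) * (- ((- 1) ^ i * c) / ((1 + real i) * fact i)) = - ((- 1) ^ i * c / fact i)" for c :: real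
    by (simp add: divide_simps)
  then show ?thesis by (simp add: coeff_pderiv coeff_laguerre)
qed

lemma pderiv_laguerre_Suc: "pderiv (laguerre n) - pderiv (laguerre (Suc n)) = laguerre n"
  by (rule poly_eqI)
    (simp add: coeff_pderiv_laguerre coeff_laguerre add_divide_distrib algebra_simps)

text \<open>The truncated \<open>n - 1\<close> at \<open>n = 0\<close> is harmless, since it is
  multiplied by \<open>n\<close>.\<close>

lemma X_pderiv_laguerre: "X * pderiv (laguerre n) = of_nat n * (laguerre n - laguerre (n - 1))"
proof (rule poly_eqI)
  fix i
  show "coeff (X * pderiv (laguerre n)) i = coeff (of_nat n * (laguerre n - laguerre (n - 1))) i"
  proof (cases n)
    case (Suc m)
    show ?thesis
    proof (cases i)
      case (Suc k)
      define c :: real where "c = (- 1) ^ Suc k / fact (Suc k)"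
      have c: "coeff (laguerre l) (Suc k) = c * real (l choose Suc k)" for l
        by (simp add: coeff_laguerre c_def)
      have "real (Suc k) * real (Suc m choose Suc k) = real (Suc m) * (real (Suc m choose Suc k) - real (m choose Suc k))"
        by (metis Suc_times_binomial_eq add_diff_cancel_right' binomial_Suc_Suc mult.commute of_nat_add of_nat_mult)
      then have "c * (real (Suc k) * real (Suc m choose Suc k)) =
          c * (real (Suc m) * (real (Suc m choose Suc k) - real (m choose Suc k)))"
        by simp
      then show ?thesis
        by (simp add: \<open>n = Suc m\<close> Suc coeff_pCons coeff_pderiv c of_nat_poly algebra_simps del: binomial_Suc_Suc)
    qed (simp add: coeff_laguerre of_nat_poly)
  qed simp
qed

lemma laguerre_rec:
  "of_nat (Suc n) * laguerre (Suc n) = (of_nat (2 * n + 1) - X) * laguerre n - of_nat n * laguerre (n - 1)"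
proof -
  have "of_nat (Suc n) * laguerre (Suc n) = of_nat (Suc n) * laguerre n + X * pderiv (laguerre (Suc n))"
    by (simp only: X_pderiv_laguerre diff_Suc_1 right_diff_distrib)
  also have "pderiv (laguerre (Suc n)) = pderiv (laguerre n) - laguerre n"
    using pderiv_laguerre_Suc[of n] by (simp add: algebra_simps)
  also have "X * (pderiv (laguerre n) - laguerre n) = of_nat n * (laguerre n - laguerre (n - 1)) - X * laguerre n"
    by (simp only: right_diff_distrib X_pderiv_laguerre)
  finally show ?thesis by (simp only: algebra_simps of_nat_Suc of_nat_mult of_nat_add of_nat_numeral of_nat_1 mult_2)
qed

text \<open>The Sturm-Liouville equation \<open>(x e^(-x) L_n')' = - n e^(-x) L_n\<close> with the
  exponential divided out.\<close>

lemma laguerre_ode: "X * pderiv (laguerre n) - pderiv (X * pderiv (laguerre n)) = of_nat n * laguerre n"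
proof (cases n)
  case (Suc m)
  have "pderiv (X * pderiv (laguerre n)) = of_nat n * (pderiv (laguerre n) - pderiv (laguerre m))"
    unfolding X_pderiv_laguerre by (simp add: Suc of_nat_poly pderiv_smult pderiv_diff)
  also have "pderiv (laguerre n) - pderiv (laguerre m) = - laguerre m"
    using pderiv_laguerre_Suc[of m] unfolding Suc by (metis minus_diff_eq)
  finally show ?thesis unfolding X_pderiv_laguerre by (simp add: Suc algebra_simps)
qed simp

text \<open>Integration by parts turns the eigenvalue equation into a Dirichlet form. For
  \<open>f = laguerre m\<close> this form is symmetric, whence orthogonality for distinct
  eigenvalues.\<close>

lemma exp_moment_laguerre_mult:
  "real n * exp_moment (f * laguerre n) = exp_moment (X * (pderiv f * pderiv (laguerre n)))"
proof -
  let ?g = "pderiv (laguerre n)"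
  have "real n * exp_moment (f * laguerre n) = exp_moment (f * (of_nat n * laguerre n))"
    by (simp add: exp_moment_of_nat[symmetric] mult.left_commute)
  also have "\<dots> = exp_moment (X * (f * ?g)) - exp_moment (f * pderiv (X * ?g))"
    unfolding laguerre_ode[symmetric] right_diff_distrib exp_moment_diff by (simp only: mult.left_commute)
  also have "f * pderiv (X * ?g) = pderiv (X * (f * ?g)) - X * (pderiv f * ?g)"
    by (simp only: pderiv_mult algebra_simps)
  finally show ?thesis by (simp only: exp_moment_diff exp_moment_pderiv_X_mult)
qed

lemma laguerre_orthogonal:
  assumes "m \<noteq> n" shows "exp_moment (laguerre m * laguerre n) = 0"
proof -
  have "real n * exp_moment (laguerre m * laguerre n) = real m * exp_moment (laguerre m * laguerre n)"
    using exp_moment_laguerre_mult[of n "laguerre m"] exp_moment_laguerre_mult[of m "laguerre n"]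
    by (simp add: mult.commute)
  then show ?thesis using assms by simp
qed

section \<open>Moments of products of neighbouring Laguerre polynomials\<close>

definition diag_mom :: "nat \<Rightarrow> nat \<Rightarrow> real" where
  "diag_mom N n = exp_moment (X ^ n * (laguerre N * laguerre N))"

definition off_mom :: "nat \<Rightarrow> nat \<Rightarrow> real" where
  "off_mom N n = exp_moment (X ^ n * (laguerre N * laguerre (N - 1)))"

lemma diag_mom_Suc:
  "diag_mom N (Suc n) = (real n + 1 + 2 * real N) * diag_mom N n - 2 * real N * off_mom N n"
proof -
  have "X * pderiv (laguerre N * laguerre N)
      = of_nat (2 * N) * (laguerre N * laguerre N) - of_nat (2 * N) * (laguerre N * laguerre (N - 1))"
    using X_pderiv_laguerre[of N] unfolding pderiv_mult of_nat_mult of_nat_numeral by Groebner_Basis.algebra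
  from exp_moment_X_power_pderiv[of n "laguerre N * laguerre N", unfolded this]
  show ?thesis
    unfolding right_diff_distrib exp_moment_diff mult.left_commute[of "X ^ n" "of_nat i" for i] exp_moment_of_nat
    by (simp add: diag_mom_def off_mom_def algebra_simps)
qed

lemma X_pderiv_laguerre_Suc:
  "X * pderiv (laguerre n) = of_nat (Suc n) * laguerre (Suc n) - of_nat (Suc n) * laguerre n + X * laguerre n"
proof -
  have "X * pderiv (laguerre n) = X * pderiv (laguerre (Suc n)) + X * laguerre n"
    using pderiv_laguerre_Suc[of n] by (metis add.commute diff_add_cancel distrib_left)
  then show ?thesis by (simp only: X_pderiv_laguerre diff_Suc_1 right_diff_distrib)
qed

text \<open>Here the derivative of \<open>L_n\<close> is expressed through \<open>L_(n+1)\<close>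
  instead of \<open>L_(n-1)\<close>. With \<open>diag_mom_Suc\<close> at \<open>Suc n\<close>, both
  neighbouring diagonal moments then involve the same mixed moment.\<close>

lemma diag_mom_Suc_off_mom_Suc:
  "diag_mom n (Suc m) = (2 * real (Suc n) - real m - 1) * diag_mom n m - 2 * real (Suc n) * off_mom (Suc n) m"
proof -
  have "X * pderiv (laguerre n * laguerre n)
      = of_nat (2 * Suc n) * (laguerre (Suc n) * laguerre n) - of_nat (2 * Suc n) * (laguerre n * laguerre n)
        + of_nat 2 * (X * (laguerre n * laguerre n))"
    using X_pderiv_laguerre_Suc[of n] unfolding pderiv_mult of_nat_mult of_nat_numeral by Groebner_Basis.algebra
  from exp_moment_X_power_pderiv[of m "laguerre n * laguerre n", unfolded this]
  show ?thesis
    unfolding right_diff_distrib distrib_left exp_moment_diff exp_moment_add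
      mult.left_commute[of "X ^ m" "of_nat i" for i] exp_moment_of_nat
    by (simp add: diag_mom_def off_mom_def algebra_simps)
qed

lemma off_mom_eq:
  "(real m + 1) * off_mom (Suc n) m = real (Suc n) * (diag_mom n m - diag_mom (Suc n) m)"
proof -
  have "X * pderiv (laguerre (Suc n) * laguerre n)
      = of_nat (Suc n) * (laguerre (Suc n) * laguerre (Suc n)) - of_nat (Suc n) * (laguerre n * laguerre n)
        + X * (laguerre (Suc n) * laguerre n)"
    using X_pderiv_laguerre_Suc[of n] X_pderiv_laguerre[of "Suc n"]
    unfolding pderiv_mult diff_Suc_1 by Groebner_Basis.algebra
  from exp_moment_X_power_pderiv[of m "laguerre (Suc n) * laguerre n", unfolded this]
  show ?thesis
    unfolding right_diff_distrib distrib_left exp_moment_diff exp_moment_add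
      mult.left_commute[of "X ^ m" "of_nat i" for i] exp_moment_of_nat
    by (simp add: diag_mom_def off_mom_def algebra_simps)
qed

lemma diag_mom_0: "diag_mom n 0 = 1"
proof (induction n)
  case 0
  show ?case by (simp add: diag_mom_def exp_moment_def)
next
  case (Suc n)
  have "off_mom (Suc n) 0 = 0" by (simp add: off_mom_def laguerre_orthogonal)
  with off_mom_eq[of 0 n] Suc show ?case by simp
qed

text \<open>
  This is the confluent Christoffel-Darboux formula, in the form that
  \<open>x e\<^sup>-\<^sup>x (L\<^sub>0\<^sup>2 + \<dots> + L\<^sub>N\<^sub>-\<^sub>1\<^sup>2)\<close> has the derivative \<open>N e\<^sup>-\<^sup>x L\<^sub>N L\<^sub>N\<^sub>-\<^sub>1\<close>, tested against \<open>x\<^sup>m\<close>.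
\<close>
lemma sum_diag_mom: "real m * (\<Sum>k<N. diag_mom k m) = - (real N * off_mom N m)"
proof (induction N)
  case (Suc N)
  let ?A = "laguerre N * laguerre N"
  \<comment> \<open>The left side is \<open>e^x\<close> times the derivative of
    \<open>x e^(-x) L_N^2\<close>, so this is the increment in \<open>N\<close> of the
    Christoffel-Darboux formula.\<close>
  have "?A - X * ?A + X * pderiv ?A
      = of_nat (Suc N) * (laguerre (Suc N) * laguerre N) - of_nat N * (laguerre N * laguerre (N - 1))"
    using laguerre_rec[of N] X_pderiv_laguerre[of N]
    unfolding pderiv_mult of_nat_Suc of_nat_mult of_nat_add of_nat_numeral of_nat_1 by Groebner_Basis.algebra
  then have "exp_moment (X ^ m * (?A - X * ?A + X * pderiv ?A)) = exp_moment (X ^ m *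
      (of_nat (Suc N) * (laguerre (Suc N) * laguerre N) - of_nat N * (laguerre N * laguerre (N - 1))))"
    by (simp only:)
  then have "- (real m * diag_mom N m) = real (Suc N) * off_mom (Suc N) m - real N * off_mom N m"
    unfolding right_diff_distrib distrib_left exp_moment_diff exp_moment_add exp_moment_X_power_pderiv
      mult.left_commute[of "X ^ m" "of_nat i" for i] exp_moment_of_nat
    by (simp add: diag_mom_def off_mom_def algebra_simps)
  with Suc show ?case by (simp add: algebra_simps)
qed simp

lemma sum_diag_mom_rec:
  "(real m + 3) * (\<Sum>k<N. diag_mom k (m + 2)) =
     2 * real N * (2 * real m + 3) * (\<Sum>k<N. diag_mom k (m + 1))
     + real m * (real m + 1)\<^sup>2 * (\<Sum>k<N. diag_mom k m)"
proof (cases N)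
  case (Suc n)
  \<comment> \<open>The difference \<open>d\<close>, the sum \<open>s\<close> and the mixed moment
    \<open>b\<close> satisfy a closed linear system in the exponent, and \<open>M\<close> is
    recovered from \<open>d\<close> alone.\<close>
  define M d s b where "M i = (\<Sum>k<N. diag_mom k i)" and "d i = diag_mom N i - diag_mom n i"
    and "s i = diag_mom N i + diag_mom n i" and "b i = off_mom N i" for i
  define R where "R = real N"
  have "R \<noteq> 0" by (simp add: R_def Suc)
  have Rb: "(real i + 1) * b i = - (R * d i)" for i
    using off_mom_eq[of i n] by (simp add: b_def d_def Suc R_def algebra_simps)
  have dS: "d (Suc i) = (real i + 1) * s i + 2 * R * d i" for i
    using diag_mom_Suc[of N i] diag_mom_Suc_off_mom_Suc[of n i] by (simp add: b_def d_def s_def Suc R_def algebra_simps)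
  have sS: "s (Suc i) = (real i + 1) * d i + 2 * R * s i - 4 * R * b i" for i
    using diag_mom_Suc[of N i] diag_mom_Suc_off_mom_Suc[of n i] by (simp add: b_def d_def s_def Suc R_def algebra_simps)
  have M: "(real i + 1) * (real i * M i) = R\<^sup>2 * d i" for i
  proof -
    have "(real i + 1) * (real i * M i) = - (R * ((real i + 1) * b i))"
      using sum_diag_mom[of i N] by (simp add: M_def b_def R_def)
    then show ?thesis unfolding Rb by (simp add: power2_eq_square)
  qed
  \<comment> \<open>Elimination of \<open>s\<close> and \<open>b\<close>; the factor
    \<open>m + 1\<close> clears the denominators that occur when both are expressed through
    \<open>d\<close>.\<close>
  have "(real m + 1) * d (m + 2) = (real m + 2) * ((real m + 1)\<^sup>2 * d m) + 2 * R * (2 * real m + 3) * d (m + 1)"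
    using dS[of m] dS[of "Suc m"] sS[of m] Rb[of m] by simp Groebner_Basis.algebra
  then have "R\<^sup>2 * ((real m + 1) * d (m + 2)) =
      R\<^sup>2 * ((real m + 2) * ((real m + 1)\<^sup>2 * d m) + 2 * R * (2 * real m + 3) * d (m + 1))"
    by (simp only:)
  then have "(real m + 1) * (R\<^sup>2 * d (m + 2)) =
      (real m + 2) * ((real m + 1)\<^sup>2 * (R\<^sup>2 * d m)) + 2 * R * (2 * real m + 3) * (R\<^sup>2 * d (m + 1))"
    by (simp add: algebra_simps)
  then have "((real m + 1) * (real m + 2)) * ((real m + 3) * M (m + 2)) =
      ((real m + 1) * (real m + 2)) * (2 * R * (2 * real m + 3) * M (m + 1) + real m * (real m + 1)\<^sup>2 * M m)"
    unfolding M[symmetric] by (simp add: algebra_simps power2_eq_square)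
  moreover have "(real m + 1) * (real m + 2) \<noteq> 0" by (simp add: add_nonneg_eq_0_iff)
  ultimately have "(real m + 3) * M (m + 2) = 2 * R * (2 * real m + 3) * M (m + 1) + real m * (real m + 1)\<^sup>2 * M m"
    using mult_left_cancel by blast
  then show ?thesis by (simp add: M_def R_def)
qed simp

lemma sum_diag_mom_0: "(\<Sum>k<N. diag_mom k 0) = real N"
  by (simp add: diag_mom_0)

lemma sum_diag_mom_1: "(\<Sum>k<N. diag_mom k 1) = (real N)\<^sup>2"
proof (cases N)
  case (Suc n)
  have "off_mom N 0 = 0" by (simp add: off_mom_def laguerre_orthogonal Suc)
  then have d: "diag_mom N 1 - diag_mom n 1 = 2"
    using diag_mom_Suc[of N 0] diag_mom_Suc_off_mom_Suc[of n 0] by (simp add: diag_mom_0 Suc)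
  have "2 * (\<Sum>k<N. diag_mom k 1) = - (real N * ((real 1 + 1) * off_mom N 1))"
    using sum_diag_mom[of 1 N] by simp
  also have "(real 1 + 1) * off_mom N 1 = real N * (diag_mom n 1 - diag_mom N 1)"
    using off_mom_eq[of 1 n] by (simp only: Suc)
  also have "- (real N * (real N * (diag_mom n 1 - diag_mom N 1))) = real N * (real N * (diag_mom N 1 - diag_mom n 1))"
    by (simp add: algebra_simps)
  finally show ?thesis unfolding d by (simp add: power2_eq_square)
qed simp

subsection \<open>Reduction of the ensemble to one-point moments\<close>

text \<open>Induction on \<open>n\<close>: as a function of the last point the determinant is a
  polynomial of degree at most \<open>n\<close>, with roots at the other points and with leading
  coefficient given by the smaller determinant.\<close>

lemma det_poly_eq_vandermonde:
  fixes P :: "nat \<Rightarrow> real poly" and x :: "nat \<Rightarrow> real"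
  assumes "\<And>j. j < n \<Longrightarrow> degree (P j) \<le> j"
  shows "det (mat n n (\<lambda>(i, j). poly (P j) (x i))) = (\<Prod>j<n. coeff (P j) j) * (\<Prod>j<n. \<Prod>i<j. x j - x i)"
  using assms
proof (induction n)
  case 0
  show ?case by (simp add: det_dim_zero[of "mat 0 0 f" for f])
next
  case (Suc n)
  define D where "D = (\<Prod>j<n. coeff (P j) j) * (\<Prod>j<n. \<Prod>i<j. x j - x i)"
  have IH: "det (mat n n (\<lambda>(i, j). poly (P j) (x i))) = D"
    unfolding D_def using Suc.prems by (intro Suc.IH) simp
  \<comment> \<open>Only the last row depends on \<open>t\<close>, so its cofactors do not, and
    expansion along that row gives the polynomial \<open>Q\<close>.\<close>
  define A where "A t = mat (Suc n) (Suc n) (\<lambda>(i, j). poly (P j) (if i = n then t else x i))" for t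
  have A_carrier: "A t \<in> carrier_mat (Suc n) (Suc n)" for t by (simp add: A_def)
  have cof: "cofactor (A t) n j = cofactor (A 0) n j" for t j
    unfolding cofactor_def
    by (intro arg_cong2[where f = "(*)"] refl arg_cong[where f = det]) (auto simp: mat_delete_def A_def)
  define Q where "Q = (\<Sum>j<Suc n. Polynomial.smult (cofactor (A 0) n j) (P j))"
  have poly_Q: "poly Q t = det (A t)" for t
    unfolding laplace_expansion_row[OF A_carrier lessI] cof[of t]
    by (simp add: Q_def poly_sum A_def mult.commute del: sum.lessThan_Suc)
  have deg_Q: "degree Q \<le> n"
    unfolding Q_def
  proof (rule degree_sum_le)
    fix j assume j: "j \<in> {..<Suc n}"
    have "degree (Polynomial.smult (cofactor (A 0) n j) (P j)) \<le> degree (P j)" by (rule degree_smult_le)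
    also have "\<dots> \<le> j" using Suc.prems j by simp
    also have "\<dots> \<le> n" using j by simp
    finally show "degree (Polynomial.smult (cofactor (A 0) n j) (P j)) \<le> n" .
  qed simp
  have "mat_delete (A 0) n n = mat n n (\<lambda>(i, j). poly (P j) (x i))"
    by (rule eq_matI) (auto simp: mat_delete_def A_def)
  then have "cofactor (A 0) n n = D"
    by (simp add: cofactor_def IH)
  moreover have "coeff (P j) n = 0" if "j < n" for j
    using that Suc.prems[of j] by (intro coeff_eq_0) auto
  ultimately have coeff_Q: "coeff Q n = D * coeff (P n) n"
    by (simp add: Q_def coeff_sum)
  have root: "poly Q (x i) = 0" if "i < n" for i
    unfolding poly_Q
    by (rule det_identical_rows[OF A_carrier, of i n]) (use that in \<open>auto simp: A_def\<close>)
  have "poly Q (x n) = D * coeff (P n) n * (\<Prod>i<n. x n - x i)"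
  \<comment> \<open>If two earlier points coincide, both sides vanish. Otherwise the
    \<open>n\<close> distinct roots determine \<open>Q\<close> up to its leading
    coefficient.\<close>
  proof (cases "inj_on x {..<n}")
    case False
    then obtain i j where ij: "i < n" "j < n" "x i = x j" "i < j"
      unfolding inj_on_def by (metis lessThan_iff linorder_neqE_nat)
    then have "(\<Prod>i<j. x j - x i) = 0" by (intro prod_zero bexI[of _ i]) auto
    then have "\<exists>j\<in>{..<n}. (\<Prod>i<j. x j - x i) = 0" using ij(2) by blast
    then have "(\<Prod>j<n. \<Prod>i<j. x j - x i) = 0" by (rule prod_zero[OF finite_lessThan])
    then have "D = 0" by (simp add: D_def)
    moreover have "det (A (x n)) = 0"
      by (rule det_identical_rows[OF A_carrier, of i j]) (use ij in \<open>auto simp: A_def\<close>)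
    ultimately show ?thesis by (simp add: poly_Q)
  next
    case True
    define R where "R = (\<Prod>i<n. [:- x i, 1:])"
    have deg_R: "degree R = n"
      by (simp add: R_def degree_prod_eq_sum_degree)
    have "lead_coeff R = 1"
      by (simp add: R_def lead_coeff_prod)
    define S where "S = Q - Polynomial.smult (coeff Q n) R"
    have "S = 0"
    proof (rule ccontr)
      assume "S \<noteq> 0"
      have "degree S \<le> n" unfolding S_def using deg_Q deg_R by (intro degree_diff_le) auto
      moreover have "coeff S n = 0"
        using \<open>lead_coeff R = 1\<close> by (simp add: S_def deg_R)
      ultimately have "degree S < n \<or> n = 0"
        using \<open>S \<noteq> 0\<close> by (metis le_neq_implies_less leading_coeff_0_iff)
      moreover have "n \<noteq> 0"
        using \<open>S \<noteq> 0\<close> \<open>degree S \<le> n\<close> \<open>coeff S n = 0\<close> by (metis le_zero_eq leading_coeff_0_iff)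
      moreover have "x ` {..<n} \<subseteq> {t. poly S t = 0}"
        by (auto simp: S_def root R_def poly_prod)
      then have "card (x ` {..<n}) \<le> card {t. poly S t = 0}"
        using \<open>S \<noteq> 0\<close> by (intro card_mono poly_roots_finite)
      then have "n \<le> degree S"
        using card_poly_roots_bound[OF \<open>S \<noteq> 0\<close>] True by (simp add: card_image)
      ultimately show False by simp
    qed
    then show ?thesis
      by (simp add: S_def coeff_Q R_def poly_prod)
  qed
  moreover have "A (x n) = mat (Suc n) (Suc n) (\<lambda>(i, j). poly (P j) (x i))"
    by (rule eq_matI) (auto simp: A_def)
  ultimately show ?case by (simp add: poly_Q D_def)
qed

text \<open>The Kronecker factors force \<open>p\<close> and \<open>q\<close> to agree away from
  \<open>l\<close>, hence everywhere. Each of the \<open>N!\<close> diagonal terms has sign 1 and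
  contributes the trace of \<open>G\<close>.\<close>

lemma sum_permutations_mult_diag:
  fixes G :: "nat \<Rightarrow> nat \<Rightarrow> real"
  shows "(\<Sum>p | p permutes {0..<N}. \<Sum>q | q permutes {0..<N}. signof p * signof q *
      (\<Sum>l<N. \<Prod>i<N. if i = l then G (p i) (q i) else if p i = q i then 1 else 0))
    = fact N * (\<Sum>k<N. G k k)"
proof -
  define U where "U = {p. p permutes {0..<N}}"
  have fin: "finite U" by (simp add: U_def finite_permutations)
  have zero: "(\<Prod>i<N. if i = l then G (p i) (q i) else if p i = q i then 1 else 0) = 0"
    if "p \<in> U" "q \<in> U" "p \<noteq> q" "l < N" for p q l
  proof -
    have "\<exists>i<N. i \<noteq> l \<and> p i \<noteq> q i"
    proof (rule ccontr)
      assume *: "\<not> ?thesis"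
      have p: "p permutes {..<N}" and q: "q permutes {..<N}" using that by (auto simp: U_def atLeast0LessThan)
      have "p i = q i" if "i \<noteq> l" for i
        using * that p q by (cases "i < N") (auto simp: permutes_def)
      moreover from this have "p l = q l"
        using p q by (metis permutes_inverses(1) permutes_inverses(2))
      ultimately show False using \<open>p \<noteq> q\<close> by (metis ext)
    qed
    then show ?thesis by (intro prod_zero) auto
  qed
  have diag: "(\<Sum>l<N. \<Prod>i<N. if i = l then G (p i) (p i) else if p i = p i then 1 else 0) = (\<Sum>k<N. G k k)"
    if "p \<in> U" for p
  proof -
    have "(\<Sum>l<N. \<Prod>i<N. if i = l then G (p i) (p i) else if p i = p i then 1 else 0) = (\<Sum>l<N. G (p l) (p l))"
      by (intro sum.cong refl) (simp add: prod.delta cong: if_cong)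
    also have "\<dots> = (\<Sum>k<N. G k k)"
      using that sum.permute[of p "{..<N}" "\<lambda>k. G k k"] by (simp add: U_def atLeast0LessThan o_def)
    finally show ?thesis .
  qed
  have "(\<Sum>p\<in>U. \<Sum>q\<in>U. signof p * signof q *
      (\<Sum>l<N. \<Prod>i<N. if i = l then G (p i) (q i) else if p i = q i then 1 else 0))
    = (\<Sum>p\<in>U. \<Sum>q\<in>U. if q = p then \<Sum>k<N. G k k else 0)"
  proof (intro sum.cong refl)
    fix p q assume pq: "p \<in> U" "q \<in> U"
    show "signof p * signof q * (\<Sum>l<N. \<Prod>i<N. if i = l then G (p i) (q i) else if p i = q i then 1 else 0)
        = (if q = p then \<Sum>k<N. G k k else 0)"
    proof (cases "q = p")
      case True
      have "signof p * signof p = (1 :: real)" by (simp add: sign_def)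
      then show ?thesis unfolding True diag[OF pq(1)] by simp
    next
      case False
      then show ?thesis using zero[OF pq] by (auto intro!: sum.neutral)
    qed
  qed
  also have "\<dots> = fact N * (\<Sum>k<N. G k k)"
    using fin by (simp add: U_def card_permutations)
  finally show ?thesis by (simp add: U_def)
qed

text \<open>Both determinants are expanded over permutations and the statistic over its summands
  \<open>l\<close>. Every resulting term is a product over coordinates, to which Fubini applies, and
  orthonormality leaves the sum of the previous lemma.\<close>

lemma andreief_linear_statistic:
  fixes phi :: "nat \<Rightarrow> real \<Rightarrow> real" and w f :: "real \<Rightarrow> real"
  assumes orth: "\<And>j k. j < N \<Longrightarrow> k < N \<Longrightarrow>
      has_bochner_integral lborel (\<lambda>x. phi j x * phi k x * w x) (if j = k then 1 else 0)"
    and stat: "\<And>j k. j < N \<Longrightarrow> k < N \<Longrightarrow>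
      has_bochner_integral lborel (\<lambda>x. phi j x * phi k x * w x * f x) (G j k)"
  shows "has_bochner_integral (\<Pi>\<^sub>M i\<in>{..<N}. lborel)
     (\<lambda>x. (det (mat N N (\<lambda>(i, j). phi j (x i))))\<^sup>2 * (\<Prod>i<N. w (x i)) * (\<Sum>i<N. f (x i)))
     (fact N * (\<Sum>k<N. G k k))"
proof -
  interpret product_sigma_finite "\<lambda>_::nat. lborel :: real measure" by standard
  define U where "U = {p. p permutes {0..<N}}"
  have fin: "finite U" by (simp add: U_def finite_permutations)
  have U_less: "p i < N" if "p \<in> U" "i < N" for p i
    using that permutes_in_image[of p "{0..<N}" i] by (simp add: U_def)
  define h where "h p q l i y = phi (p i) y * phi (q i) y * w y * (if i = l then f y else 1)" for p q :: "nat \<Rightarrow> nat" and l i y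
  define H where "H p q l i = (if i = l then G (p i) (q i) else if p i = q i then 1 else 0)" for p q :: "nat \<Rightarrow> nat" and l i
  have h_int: "has_bochner_integral lborel (h p q l i) (H p q l i)" if "p \<in> U" "q \<in> U" "i < N" for p q l i
    using stat[OF U_less[OF that(1,3)] U_less[OF that(2,3)]] orth[OF U_less[OF that(1,3)] U_less[OF that(2,3)]]
    by (cases "i = l") (simp_all add: h_def[abs_def] H_def)
  have prod_int: "has_bochner_integral (\<Pi>\<^sub>M i\<in>{..<N}. lborel) (\<lambda>x. \<Prod>i<N. h p q l i (x i)) (\<Prod>i<N. H p q l i)"
    if "p \<in> U" "q \<in> U" for p q l
  proof -
    have "integrable lborel (h p q l i)" "integral\<^sup>L lborel (h p q l i) = H p q l i" if "i \<in> {..<N}" for i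
      using h_int[OF \<open>p \<in> U\<close> \<open>q \<in> U\<close>, of i l] that by (auto simp: has_bochner_integral_iff)
    then show ?thesis
      unfolding has_bochner_integral_iff
      by (auto intro!: product_integrable_prod product_integral_prod[THEN trans] prod.cong)
  qed
  have "(det (mat N N (\<lambda>(i, j). phi j (x i))))\<^sup>2 * (\<Prod>i<N. w (x i)) * (\<Sum>i<N. f (x i)) =
      (\<Sum>p\<in>U. \<Sum>q\<in>U. signof p * signof q * (\<Sum>l<N. \<Prod>i<N. h p q l i (x i)))" for x
  proof -
    have det_eq: "det (mat N N (\<lambda>(i, j). phi j (x i))) = (\<Sum>p\<in>U. signof p * (\<Prod>i<N. phi (p i) (x i)))"
      unfolding det_def'[of _ N, OF mat_carrier] U_def
      by (intro sum.cong refl arg_cong2[where f = "(*)"] prod.cong) (auto simp: U_less[unfolded U_def] atLeast0LessThan)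
    have h_prod: "(\<Prod>i<N. h p q l i (x i)) =
        (\<Prod>i<N. phi (p i) (x i)) * (\<Prod>i<N. phi (q i) (x i)) * (\<Prod>i<N. w (x i)) * f (x l)" if "l < N" for p q l
      using that by (simp add: h_def prod.distrib prod.delta)
    define W F where "W = (\<Prod>i<N. w (x i))" and "F = (\<Sum>i<N. f (x i))"
    have "(\<Sum>l<N. \<Prod>i<N. h p q l i (x i)) = (\<Prod>i<N. phi (p i) (x i)) * (\<Prod>i<N. phi (q i) (x i)) * W * F" for p q
      unfolding F_def W_def sum_distrib_left by (intro sum.cong refl h_prod) simp
    then have "(\<Sum>p\<in>U. \<Sum>q\<in>U. signof p * signof q * (\<Sum>l<N. \<Prod>i<N. h p q l i (x i)))
        = (\<Sum>p\<in>U. \<Sum>q\<in>U. (signof p * (\<Prod>i<N. phi (p i) (x i))) * (signof q * (\<Prod>i<N. phi (q i) (x i))) * (W * F))"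
      by (intro sum.cong refl) (simp only: mult_ac)
    also have "\<dots> = (\<Sum>p\<in>U. signof p * (\<Prod>i<N. phi (p i) (x i))) * (\<Sum>q\<in>U. signof q * (\<Prod>i<N. phi (q i) (x i))) * (W * F)"
      by (subst sum_product) (simp only: sum_distrib_right)
    finally show ?thesis
      unfolding det_eq power2_eq_square W_def F_def by (simp only: mult.assoc)
  qed
  moreover have "has_bochner_integral (\<Pi>\<^sub>M i\<in>{..<N}. lborel)
      (\<lambda>x. \<Sum>p\<in>U. \<Sum>q\<in>U. signof p * signof q * (\<Sum>l<N. \<Prod>i<N. h p q l i (x i)))
      (\<Sum>p\<in>U. \<Sum>q\<in>U. signof p * signof q * (\<Sum>l<N. \<Prod>i<N. H p q l i))"
    by (intro has_bochner_integral_sum has_bochner_integral_mult_right prod_int)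
  moreover have "(\<Sum>p\<in>U. \<Sum>q\<in>U. signof p * signof q * (\<Sum>l<N. \<Prod>i<N. H p q l i)) = fact N * (\<Sum>k<N. G k k)"
    unfolding U_def H_def by (rule sum_permutations_mult_diag)
  ultimately show ?thesis by simp
qed

section \<open>Integrals against the Laguerre weight and normalisation of the ensemble\<close>

lemma has_bochner_integral_exp_moment:
  "has_bochner_integral lborel (\<lambda>x. poly p x * (exp (- x) * indicator {0..} x)) (exp_moment p)"
proof -
  have mono: "has_bochner_integral lborel (\<lambda>x. x ^ k * (exp (- x) * indicator {0..} x)) (fact k :: real)" for k
  proof (rule has_bochner_integral_nn_integral)
    have "(\<integral>\<^sup>+x. ennreal (x ^ k * (exp (- x) * indicator {0..} x)) \<partial>lborel)
        = (\<integral>\<^sup>+x. ennreal (x ^ k * exp (- x)) * indicator {0..} x \<partial>lborel)"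
      by (intro nn_integral_cong) (simp add: indicator_def)
    then show "(\<integral>\<^sup>+x. ennreal (x ^ k * (exp (- x) * indicator {0..} x)) \<partial>lborel) = ennreal (fact k)"
      by (simp add: nn_intergal_power_times_exp_Ici)
  qed (auto simp: indicator_def)
  have "has_bochner_integral lborel (\<lambda>x. \<Sum>k\<le>degree p. coeff p k * (x ^ k * (exp (- x) * indicator {0..} x))) (exp_moment p)"
    unfolding exp_moment_def by (intro has_bochner_integral_sum has_bochner_integral_mult_right mono)
  then show ?thesis by (simp add: poly_altdef sum_distrib_right mult.assoc)
qed

lemma has_bochner_integral_exp_moment_scaled:
  assumes "c > 0"
  shows "has_bochner_integral lborel (\<lambda>x. poly p (c * x) * (c * exp (- c * x) * indicator {0..} x)) (exp_moment p)"
proof -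
  have "has_bochner_integral lborel (\<lambda>x. poly p (0 + c * x) * (exp (- (0 + c * x)) * indicator {0..} (0 + c * x))) (exp_moment p /\<^sub>R \<bar>c\<bar>)"
    using assms by (intro lborel_has_bochner_integral_real_affine_iff[THEN iffD1] has_bochner_integral_exp_moment) auto
  from has_bochner_integral_mult_right[OF this, of c]
  have "has_bochner_integral lborel
      (\<lambda>x. c * (poly p (c * x) * (exp (- (c * x)) * indicator {0..} (c * x)))) (c * (exp_moment p /\<^sub>R \<bar>c\<bar>))"
    by simp
  moreover have "c * (exp_moment p /\<^sub>R \<bar>c\<bar>) = exp_moment p" using assms by simp
  moreover have "indicator {0..} (c * x) = (indicator {0..} x :: real)" for x
    using assms by (simp add: indicator_def zero_le_mult_iff)
  ultimately have "has_bochner_integral lborel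
      (\<lambda>x. c * (poly p (c * x) * (exp (- (c * x)) * indicator {0..} x))) (exp_moment p)"
    by (simp only:)
  then show ?thesis by (simp add: mult_ac)
qed

lemma coeff_pcompose_scale: "coeff (pcompose p [:0, c:]) j = c ^ j * coeff p j" for c :: real
proof (induction p arbitrary: j)
  case (pCons a p)
  show ?case
  proof (cases j)
    case (Suc i)
    have "coeff (pcompose (pCons a p) [:0, c:]) j = coeff ([:0, c:] * pcompose p [:0, c:]) (Suc i)"
      by (simp add: pcompose_pCons Suc)
    also have "\<dots> = c * coeff (pcompose p [:0, c:]) i" by simp
    finally show ?thesis by (simp add: pCons.IH Suc)
  qed (simp add: pcompose_pCons)
qed simp

text \<open>The constant compensates for the leading coefficients of the rescaled Laguerre
  polynomials and for the factor \<open>N\<close> put into each one-point weight. Only its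
  positivity matters later, as it cancels in the normalised density.\<close>

lemma laguerre_weight_eq_det:
  assumes "N \<ge> 1"
  shows "\<exists>\<kappa>>0. \<forall>x. laguerre_weight N x =
      \<kappa> * ((det (mat N N (\<lambda>(i, j). poly (laguerre j) (real N * x i))))\<^sup>2 *
        (\<Prod>i<N. real N * exp (- real N * x i) * indicator {0..} (x i)))"
proof (intro exI conjI allI)
  define c where "c = real N"
  have c: "c > 0" using assms by (simp add: c_def)
  define P where "P j = pcompose (laguerre j) [:0, c:]" for j
  define L where "L = (\<Prod>j<N. coeff (P j) j)"
  have "coeff (P j) j \<noteq> 0" for j
    using c by (simp add: P_def coeff_pcompose_scale coeff_laguerre)
  then have L: "L \<noteq> 0" by (simp add: L_def)
  show "1 / (L\<^sup>2 * c ^ N) > 0" using L c by simp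
  fix x :: "nat \<Rightarrow> real"
  have "degree (P j) \<le> j" for j
    by (rule degree_le) (simp add: P_def coeff_pcompose_scale coeff_laguerre)
  then have "det (mat N N (\<lambda>(i, j). poly (P j) (x i))) = L * (\<Prod>j<N. \<Prod>i<j. x j - x i)"
    unfolding L_def by (intro det_poly_eq_vandermonde)
  then have det: "det (mat N N (\<lambda>(i, j). poly (laguerre j) (c * x i))) = L * (\<Prod>j<N. \<Prod>i<j. x j - x i)"
    by (simp add: P_def poly_pcompose mult.commute)
  have vdm: "(\<Prod>j<N. \<Prod>i<j. (x i - x j)\<^sup>2) = (\<Prod>j<N. \<Prod>i<j. x j - x i)\<^sup>2"
    by (simp add: prod_power_distrib[symmetric] power2_commute)
  have exps: "(\<Prod>i<N. c * exp (- c * x i) * indicator {0..} (x i)) =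
      c ^ N * (if \<forall>i<N. 0 \<le> x i then exp (- c * (\<Sum>i<N. x i)) else 0)"
  proof (cases "\<forall>i<N. 0 \<le> x i")
    case True
    then have "(\<Prod>i<N. c * exp (- c * x i) * indicator {0..} (x i)) = (\<Prod>i<N. c * exp (- c * x i))"
      by (intro prod.cong) auto
    also have "\<dots> = c ^ N * exp (\<Sum>i<N. - c * x i)"
      by (simp only: prod.distrib exp_sum[OF finite_lessThan]) simp
    finally show ?thesis using True by (simp add: sum_distrib_left sum_negf)
  next
    case False
    then have "\<exists>i\<in>{..<N}. c * exp (- c * x i) * indicator {0..} (x i) = 0"
      by (auto simp: indicator_def)
    then have "(\<Prod>i<N. c * exp (- c * x i) * indicator {0..} (x i)) = 0"
      by (rule prod_zero[OF finite_lessThan])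
    then show ?thesis using False by (simp only: if_False mult_zero_right)
  qed
  show "laguerre_weight N x = 1 / (L\<^sup>2 * c ^ N) * ((det (mat N N (\<lambda>(i, j). poly (laguerre j) (real N * x i))))\<^sup>2 *
        (\<Prod>i<N. real N * exp (- real N * x i) * indicator {0..} (x i)))"
    unfolding c_def[symmetric] det exps laguerre_weight_def vdm
    using L c by (auto simp: power_mult_distrib)
qed

lemma trace_moment_eq_sum_diag_mom:
  assumes "N \<ge> 1"
  shows "trace_moment N n = (\<Sum>k<N. diag_mom k n) / real N ^ n"
proof -
  define c where "c = real N"
  have c: "c > 0" using assms by (simp add: c_def)
  obtain \<kappa> where \<kappa>: "\<kappa> > 0" and weight: "\<And>x. laguerre_weight N x =
      \<kappa> * ((det (mat N N (\<lambda>(i, j). poly (laguerre j) (real N * x i))))\<^sup>2 *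
        (\<Prod>i<N. real N * exp (- real N * x i) * indicator {0..} (x i)))"
    using laguerre_weight_eq_det[OF assms] by (elim exE conjE) (rule that; simp only:)
  define phi where "phi j y = poly (laguerre j) (c * y)" for j y
  define w where "w y = c * exp (- c * y) * indicator {0..} y" for y :: real
  define V where "V x = (det (mat N N (\<lambda>(i, j). phi j (x i))))\<^sup>2 * (\<Prod>i<N. w (x i))" for x
  let ?M = "\<Pi>\<^sub>M i\<in>{..<N}. (lborel :: real measure)"
  have weight: "laguerre_weight N x = \<kappa> * V x" for x
    by (simp only: weight V_def phi_def w_def c_def)
  have mom: "has_bochner_integral lborel (\<lambda>y. phi j y * phi k y * w y * y ^ m)
      (exp_moment (X ^ m * (laguerre j * laguerre k)) / c ^ m)" for j k m
  proof -
    have "has_bochner_integral lborel (\<lambda>y. poly (X ^ m * (laguerre j * laguerre k)) (c * y) * w y / c ^ m)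
        (exp_moment (X ^ m * (laguerre j * laguerre k)) / c ^ m)"
      unfolding w_def by (intro has_bochner_integral_divide_zero has_bochner_integral_exp_moment_scaled c)
    then show ?thesis
      using c by (simp add: phi_def power_mult_distrib mult_ac)
  qed
  have orth: "has_bochner_integral lborel (\<lambda>y. phi j y * phi k y * w y) (if j = k then 1 else 0)" for j k
    using mom[of j k 0] laguerre_orthogonal[of j k] diag_mom_0[of k] by (auto simp: diag_mom_def)
  \<comment> \<open>The constant statistic \<open>1 / c\<close> sums to 1 over the \<open>N\<close>
    eigenvalues, so the partition function is a case of the same integral formula.\<close>
  have orth_c: "has_bochner_integral lborel (\<lambda>y. phi j y * phi k y * w y * (1 / c)) ((if j = k then 1 else 0) * (1 / c))" for j k
    by (rule has_bochner_integral_mult_left[OF orth])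
  have "has_bochner_integral ?M (\<lambda>x. V x * (\<Sum>i<N. 1 / c)) (fact N * (\<Sum>k<N. (if k = k then 1 else 0) * (1 / c)))"
    unfolding V_def by (rule andreief_linear_statistic[OF orth orth_c])
  then have V_int: "has_bochner_integral ?M V (fact N)"
    using c by (simp add: c_def)
  then have [measurable]: "V \<in> borel_measurable ?M"
    by (simp add: has_bochner_integral_iff borel_measurable_integrable)
  have Z: "laguerre_partition N = \<kappa> * fact N"
    using has_bochner_integral_mult_right[OF V_int, of \<kappa>]
    by (simp add: laguerre_partition_def weight has_bochner_integral_iff)
  have stat: "has_bochner_integral ?M (\<lambda>x. V x * (\<Sum>i<N. x i ^ n)) (fact N * (\<Sum>k<N. diag_mom k n / c ^ n))"
    unfolding V_def diag_mom_def by (rule andreief_linear_statistic[OF orth mom])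
  have V_nonneg: "V x \<ge> 0" for x
    using c by (auto simp: V_def w_def intro!: mult_nonneg_nonneg prod_nonneg)
  have ratio: "laguerre_weight N x / laguerre_partition N = V x / fact N" for x
    using \<kappa> by (simp add: weight Z)
  have "trace_moment N n = (\<integral>x. (V x / fact N) *\<^sub>R (\<Sum>i<N. x i ^ n) \<partial>?M)"
    unfolding trace_moment_def laguerre_ensemble_def ratio
    by (rule integral_density) (auto simp: V_nonneg)
  also have "\<dots> = (\<integral>x. V x * (\<Sum>i<N. x i ^ n) \<partial>?M) / fact N"
    by simp
  also have "\<dots> = (\<Sum>k<N. diag_mom k n / c ^ n)"
    using stat by (simp add: has_bochner_integral_iff)
  finally show ?thesis by (simp add: c_def sum_divide_distrib)
qed

lemma trace_moment_0: "N \<ge> 1 \<Longrightarrow> trace_moment N 0 = real N"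
  by (simp add: trace_moment_eq_sum_diag_mom sum_diag_mom_0)

lemma trace_moment_1: "N \<ge> 1 \<Longrightarrow> trace_moment N (Suc 0) = real N"
  using sum_diag_mom_1[of N] by (simp add: trace_moment_eq_sum_diag_mom power2_eq_square)

lemma trace_moment_rec:
  assumes "N \<ge> 1"
  shows "(real n + 3) * trace_moment N (n + 2) =
    2 * (2 * real n + 3) * trace_moment N (n + 1) + real n * (real n + 1)\<^sup>2 * (trace_moment N n / (real N)\<^sup>2)"
proof -
  define c where "c = real N"
  have c: "c \<noteq> 0" using assms by (simp add: c_def)
  have "(real n + 3) * ((\<Sum>k<N. diag_mom k (n + 2)) / c ^ (n + 2)) =
     (2 * c * (2 * real n + 3) * (\<Sum>k<N. diag_mom k (n + 1))
     + real n * (real n + 1)\<^sup>2 * (\<Sum>k<N. diag_mom k n)) / c ^ (n + 2)"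
    using sum_diag_mom_rec[of n N] by (simp add: c_def)
  also have "\<dots> = 2 * (2 * real n + 3) * ((\<Sum>k<N. diag_mom k (n + 1)) / c ^ (n + 1))
     + real n * (real n + 1)\<^sup>2 * ((\<Sum>k<N. diag_mom k n) / c ^ n / c\<^sup>2)"
    using c by (simp add: add_divide_distrib power2_eq_square algebra_simps)
  finally show ?thesis
    by (simp only: trace_moment_eq_sum_diag_mom[OF assms] c_def)
qed

subsection \<open>The genus expansion\<close>

lemma moment_coeff_eq_0: "n < g \<Longrightarrow> moment_coeff n g = 0"
proof (induction n arbitrary: g rule: less_induct)
  case (less n)
  obtain h where g: "g = Suc h" using less.prems by (cases g) auto
  consider "n = 0" | "n = 1" | m where "n = m + 2"
    by (metis One_nat_def add_2_eq_Suc' not0_implies_Suc)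
  then show ?case
  proof cases
    case 3
    then have "moment_coeff (m + 1) (Suc h) = 0" "moment_coeff m h = 0"
      using less.IH[of "m + 1" "Suc h"] less.IH[of m h] less.prems g by auto
    then have "(real m + 3) * moment_coeff (m + 2) (Suc h) = 0"
      by (simp only: moment_coeff_Suc_Suc)
    then show ?thesis using 3 g by simp
  qed (use g in \<open>simp_all add: moment_coeff_0 moment_coeff_1\<close>)
qed

text \<open>The upper limit \<open>G\<close> is kept free because the three-term recursion lowers
  the genus by one in its last term, where the hypothesis is needed with
  \<open>G - 1\<close>.\<close>

lemma trace_moment_eq_genus_sum:
  assumes "N \<ge> 1"
  shows "G \<ge> n \<Longrightarrow> trace_moment N n = (\<Sum>g\<le>G. real N powi (1 - 2 * int g) * moment_coeff n g)"
proof (induction n arbitrary: G rule: less_induct)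
  case (less n)
  define S where "S G m = (\<Sum>g\<le>G. real N powi (1 - 2 * int g) * moment_coeff m g)" for G m
  \<comment> \<open>Splitting off genus 0 and extracting \<open>1 / N^2\<close> aligns genus
    \<open>Suc g\<close> with the term of genus \<open>g\<close> two indices below.\<close>
  have S_split: "S (Suc H) m = real N * moment_coeff m 0
      + (\<Sum>g\<le>H. real N powi (1 - 2 * int g) / (real N)\<^sup>2 * moment_coeff m (Suc g))" for H m
  proof -
    have "real N powi (1 - 2 * int (Suc g)) = real N powi (1 - 2 * int g) / (real N)\<^sup>2" for g
      using assms power_int_diff[of "real N" "1 - 2 * int g" 2] by (simp add: algebra_simps)
    then show ?thesis
      by (simp add: S_def sum.atMost_Suc_shift del: sum.atMost_Suc)
  qed
  consider "n = 0" | "n = 1" | m where "n = m + 2"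
    by (metis One_nat_def add_2_eq_Suc' not0_implies_Suc)
  then have "trace_moment N n = S G n"
  proof cases
    case 1
    then show ?thesis using assms
      by (cases G) (simp_all add: S_split, simp_all add: S_def moment_coeff_0 trace_moment_0)
  next
    case 2
    then obtain H where "G = Suc H" using less.prems by (cases G) auto
    moreover have "moment_coeff (Suc 0) 0 = 1"
      using moment_coeff_Suc_0[of 0] by (simp add: moment_coeff_0)
    ultimately show ?thesis using assms 2
      by (simp add: S_split moment_coeff_1 moment_coeff_0 trace_moment_1)
  next
    case 3
    then obtain H where H: "G = Suc H" using less.prems by (cases G) auto
    have "(real m + 3) * S G n
        = real N * ((real m + 3) * moment_coeff (m + 2) 0) + (\<Sum>g\<le>H. real N powi (1 - 2 * int g) / (real N)\<^sup>2
            * ((real m + 3) * moment_coeff (m + 2) (Suc g)))"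
      by (simp add: H S_split 3 distrib_left sum_distrib_left mult.left_commute)
    also have "(real m + 3) * moment_coeff (m + 2) 0 = 2 * (2 * real m + 3) * moment_coeff (m + 1) 0"
      using moment_coeff_Suc_0[of "Suc m"] by (simp add: algebra_simps)
    also have "real N * (2 * (2 * real m + 3) * moment_coeff (m + 1) 0) +
        (\<Sum>g\<le>H. real N powi (1 - 2 * int g) / (real N)\<^sup>2 * ((real m + 3) * moment_coeff (m + 2) (Suc g)))
        = 2 * (2 * real m + 3) * S (Suc H) (m + 1) + real m * (real m + 1)\<^sup>2 * (S H m / (real N)\<^sup>2)"
      unfolding moment_coeff_Suc_Suc distrib_left sum.distrib S_split
      by (simp add: S_def sum_distrib_left sum_divide_distrib mult_ac)
    also have "S (Suc H) (m + 1) = trace_moment N (m + 1)"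
      using less.IH[of "m + 1" "Suc H"] less.prems 3 H by (simp add: S_def)
    also have "S H m = trace_moment N m"
      using less.IH[of m H] less.prems 3 H by (simp add: S_def)
    also have "2 * (2 * real m + 3) * trace_moment N (m + 1) + real m * (real m + 1)\<^sup>2 * (trace_moment N m / (real N)\<^sup>2)
        = (real m + 3) * trace_moment N n"
      using trace_moment_rec[OF assms, of m] 3 by simp
    finally have "(real m + 3) * S G n = (real m + 3) * trace_moment N n" .
    then show ?thesis by (simp add: add_nonneg_eq_0_iff)
  qed
  then show ?case by (simp add: S_def)
qed

text \<open>Multiplication by \<open>N^(2G-1)\<close> makes the sum a polynomial in \<open>N\<close>
  with infinitely many roots. This makes the description of \<open>genus_coeff\<close>
  unique.\<close>

lemma powi_odd_sum_eq_0:
  assumes "\<And>N. N \<ge> 1 \<Longrightarrow> (\<Sum>g\<le>G. real N powi (1 - 2 * int g) * d g) = 0" and "g \<le> G"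
  shows "d g = 0"
proof -
  define p where "p = (\<Sum>g\<le>G. monom (d g) (2 * (G - g)))"
  have "poly p (real N) = 0" if "N \<ge> 1" for N
  proof -
    have "real N ^ (2 * (G - g)) = real N powi (2 * int G - 1) * real N powi (1 - 2 * int g)" if "g \<le> G" for g
    proof -
      have "2 * int G - 1 + (1 - 2 * int g) = int (2 * (G - g))" using that by (simp add: of_nat_diff)
      then show ?thesis using \<open>N \<ge> 1\<close> by (simp add: power_int_add[symmetric] del: of_nat_mult)
    qed
    then have "poly p (real N) = (\<Sum>g\<le>G. real N powi (2 * int G - 1) * (real N powi (1 - 2 * int g) * d g))"
      unfolding p_def poly_sum poly_monom by (intro sum.cong refl) simp
    also have "\<dots> = 0"
      unfolding sum_distrib_left[symmetric] assms(1)[OF that] by simp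
    finally show ?thesis .
  qed
  then have "real ` {1..} \<subseteq> {t. poly p t = 0}" by auto
  moreover have "infinite (real ` {1..})"
    using finite_imageD[of real "{1..}"] infinite_Ici[of "1 :: nat"] by (auto simp: inj_on_def)
  ultimately have "p = 0" by (metis infinite_super poly_roots_finite)
  have "coeff p (2 * (G - g)) = (\<Sum>h\<le>G. if h = g then d h else 0)"
    unfolding p_def coeff_sum using assms(2) by (intro sum.cong refl) auto
  then show ?thesis using assms(2) \<open>p = 0\<close> by simp
qed

lemma is_genus_expansion_moment_coeff: "is_genus_expansion moment_coeff"
  unfolding is_genus_expansion_def
proof (intro conjI allI impI)
  fix n
  have sub: "{g. moment_coeff n g \<noteq> 0} \<subseteq> {..n}"
    using moment_coeff_eq_0 by (force simp: not_less[symmetric])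
  then show "finite {g. moment_coeff n g \<noteq> 0}" by (rule finite_subset) simp
  fix N :: nat assume "N \<ge> 1"
  then show "trace_moment N n = (\<Sum>g | moment_coeff n g \<noteq> 0. real N powi (1 - 2 * int g) * moment_coeff n g)"
    unfolding trace_moment_eq_genus_sum[OF \<open>N \<ge> 1\<close> order_refl]
    by (intro sum.mono_neutral_right sub) auto
qed

lemma genus_coeff_eq: "genus_coeff = moment_coeff"
  unfolding genus_coeff_def
proof (rule the_equality)
  show "is_genus_expansion moment_coeff" by (rule is_genus_expansion_moment_coeff)
  fix c assume c: "is_genus_expansion c"
  show "c = moment_coeff"
  proof (intro ext)
    fix n g
    have "finite {g. c n g \<noteq> 0}" using c by (simp add: is_genus_expansion_def)
    then obtain K where K: "{g. c n g \<noteq> 0} \<subseteq> {..K}" by (meson finite_nat_iff_bounded_le)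
    define G where "G = max (max K n) g"
    have "g \<le> G" unfolding G_def by (rule max.cobounded2)
    have "(\<Sum>g\<le>G. real N powi (1 - 2 * int g) * (c n g - moment_coeff n g)) = 0" if "N \<ge> 1" for N
    proof -
      have "trace_moment N n = (\<Sum>g | c n g \<noteq> 0. real N powi (1 - 2 * int g) * c n g)"
        using c that by (simp add: is_genus_expansion_def)
      also have "\<dots> = (\<Sum>g\<le>G. real N powi (1 - 2 * int g) * c n g)"
        using K by (intro sum.mono_neutral_left) (auto simp: G_def)
      finally show ?thesis
        using trace_moment_eq_genus_sum[OF that, of n G]
        by (simp add: right_diff_distrib sum_subtractf G_def)
    qed
    then have "c n g - moment_coeff n g = 0"
      using \<open>g \<le> G\<close> by (rule powi_odd_sum_eq_0)
    then show "c n g = moment_coeff n g" by simp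
  qed
qed

section \<open>Summation of the genus series in the variable \<lambda>\<close>

lemma one_minus_four_over_x_of:
  "1 - 4 / x_of l = ((exp l - 1) / (exp l + 1))\<^sup>2"
proof -
  define e where "e = exp l"
  have e: "e > 0" by (simp add: e_def)
  have x: "x_of l = (e + 1)\<^sup>2 / e"
    using e by (simp add: x_of_def e_def exp_minus field_simps power2_eq_square)
  have "(e + 1)\<^sup>2 \<noteq> 0" using e by simp
  then show ?thesis unfolding x e_def[symmetric]
    using e by (simp add: power_divide divide_simps) (simp add: power2_eq_square algebra_simps)
qed

text \<open>For \<lambda> > 0 one has \<open>x > 4\<close>, so the binomial series of
  \<open>(1 - 4/x)^(k+1/2)\<close> converges; since \<open>u > 0\<close>, this power of
  \<open>u^2\<close> is \<open>u^(2k+1)\<close>.\<close>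

lemma sqrt_coeff_sums_v:
  assumes "l > 0"
  shows "(\<lambda>m. sqrt_coeff k m / x_of l ^ m) sums v k l"
proof -
  define u where "u = (exp l - 1) / (exp l + 1)"
  have "exp l > 1" using assms by simp
  then have u: "u > 0" unfolding u_def by (intro divide_pos_pos) (auto intro: add_pos_pos)
  have x0: "x_of l > 0" by (simp add: x_of_def add_pos_pos)
  have x: "1 - 4 / x_of l = u\<^sup>2" unfolding u_def by (rule one_minus_four_over_x_of)
  then have "4 / x_of l < 1" using u by (metis diff_gt_0_iff_gt zero_less_power)
  then have "\<bar>- 4 / x_of l\<bar> < 1" using x0 by simp
  from gen_binomial_real[OF this, of "real_of_int k + 1/2"]
  have "(\<lambda>m. sqrt_coeff k m / x_of l ^ m) sums ((u\<^sup>2) powr (real_of_int k + 1/2))"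
    using x by (simp only: sqrt_coeff_def power_divide times_divide_eq_right) simp
  also have "(u\<^sup>2) powr (real_of_int k + 1/2) = u powr real_of_int (2 * k + 1)"
  proof -
    have "u\<^sup>2 = u powr 2" using u by simp
    moreover have "2 * (real_of_int k + 1/2) = real_of_int (2 * k + 1)" by simp
    ultimately show ?thesis by (simp only: powr_powr)
  qed
  also have "\<dots> = v k l"
    using u powr_real_of_int'[of u "2 * k + 1"] unfolding v_def u_def[symmetric] by simp
  finally show ?thesis .
qed

text \<open>The series of \<open>W1\<close> starts at \<open>1/x\<close>, so the constant term, the
  sum of the expansion coefficients, is subtracted. It is 0 in positive genus and -1/2 in genus 0,
  which accounts for the extra 1/2 there.\<close>

lemma W1_term_sums:
  assumes "l > 0"
  shows "W1_term g (x_of l) sums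
    ((\<Sum>k\<in>index_range g. expansion_coeff g k * v k l) - (\<Sum>k\<in>index_range g. expansion_coeff g k))"
proof -
  have "(\<lambda>m. \<Sum>k\<in>index_range g. expansion_coeff g k * (sqrt_coeff k m / x_of l ^ m)) sums
      (\<Sum>k\<in>index_range g. expansion_coeff g k * v k l)"
    by (intro sums_sum sums_mult sqrt_coeff_sums_v assms)
  from sums_split_initial_segment[OF this, of 1]
  have "(\<lambda>n. \<Sum>k\<in>index_range g. expansion_coeff g k * (sqrt_coeff k (n + 1) / x_of l ^ (n + 1))) sums
      ((\<Sum>k\<in>index_range g. expansion_coeff g k * v k l) - (\<Sum>k\<in>index_range g. expansion_coeff g k * sqrt_coeff k 0))"
    by simp
  moreover have "W1_term g (x_of l) =
      (\<lambda>n. \<Sum>k\<in>index_range g. expansion_coeff g k * (sqrt_coeff k (n + 1) / x_of l ^ (n + 1)))"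
    by (rule ext) (simp add: W1_term_def genus_coeff_eq moment_coeff_def sum_divide_distrib)
  moreover have "sqrt_coeff k 0 = 1" for k
    by (simp add: sqrt_coeff_def)
  ultimately show ?thesis by (simp only: mult_1_right)
qed

subsection \<open>The one-loop mean\<close>

lemma is_W1_expansion_expansion_coeff: "is_W1_expansion expansion_coeff"
proof -
  have eq: "W1 g (x_of l) = (\<Sum>k\<in>index_range g. expansion_coeff g k * v k l) - (\<Sum>k\<in>index_range g. expansion_coeff g k)"
    if "l > 0" for g l
    using sums_unique[OF W1_term_sums[OF that, of g]] by (simp only: W1_def)
  have "(\<Sum>k\<in>index_range g. expansion_coeff g k) = 0" if "g \<ge> 1" for g
    using that sum_expansion_coeff by (cases g) auto
  moreover have "(\<Sum>k\<in>index_range 0. expansion_coeff 0 k) = - (1 / 2)"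
    by (simp add: index_range_def)
  ultimately show ?thesis
    by (simp add: is_W1_expansion_def zero_outside_range_def expansion_coeff_outside eq)
qed

lemma satisfies_recursion_expansion_coeff: "satisfies_recursion expansion_coeff"
  unfolding satisfies_recursion_def
proof (intro conjI allI impI)
  fix g :: nat and k :: int assume "g \<ge> 1"
  then obtain h where g: "g = Suc h" by (cases g) auto
  show "(\<Sum>k\<in>index_range g. expansion_coeff g k) = 0"
    unfolding g by (rule sum_expansion_coeff)
  show "let r = real_of_int k in 4 * r * expansion_coeff g k =
             (2*r + 7) * (2*r + 5) * (2*r + 3) / 32 * expansion_coeff (g - 1) (k + 3)
           - (2*r + 5) * (2*r + 3) * (r + 1) / 4 * expansion_coeff (g - 1) (k + 2)
           + 3 * (2*r + 3) * (2*r + 1)\<^sup>2 / 16 * expansion_coeff (g - 1) (k + 1)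
           - (2*r + 1) * r * (2*r - 1) / 4 * expansion_coeff (g - 1) k
           + (2*r - 1)\<^sup>2 * (2*r - 3) / 32 * expansion_coeff (g - 1) (k - 1)"
    using expansion_coeff_rec[of k h] unfolding Let_def g diff_Suc_1 rec_rhs_def .
qed (simp_all add: zero_outside_range_def expansion_coeff_outside)

section \<open>Uniqueness of the coefficients and decay at infinity\<close>

lemma satisfies_recursion_unique:
  assumes "satisfies_recursion b"
  shows "b = expansion_coeff"
proof -
  have "b g k = expansion_coeff g k" for g k
  proof (induction g arbitrary: k)
    case 0
    show ?case using assms by (simp add: satisfies_recursion_def)
  next
    case (Suc g)
    have nz: "b (Suc g) j = expansion_coeff (Suc g) j" if "j \<noteq> 0" for j
    proof -
      have "b g = expansion_coeff g" using Suc.IH by blast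
      have "4 * real_of_int j * b (Suc g) j = rec_rhs (b g) j"
        using assms that unfolding satisfies_recursion_def Let_def rec_rhs_def
        by (metis diff_Suc_1 le_add1 plus_1_eq_Suc)
      also have "\<dots> = 4 * real_of_int j * expansion_coeff (Suc g) j"
        unfolding \<open>b g = expansion_coeff g\<close> by (rule expansion_coeff_rec[symmetric])
      finally show ?thesis using that mult_left_cancel[of "4 * real_of_int j"] by auto
    qed
    have "(\<Sum>j\<in>index_range (Suc g). b (Suc g) j) = 0"
      using assms by (simp add: satisfies_recursion_def)
    also have "\<dots> = (\<Sum>j\<in>index_range (Suc g). expansion_coeff (Suc g) j)"
      by (rule sum_expansion_coeff[symmetric])
    finally have "b (Suc g) 0 + (\<Sum>j\<in>index_range (Suc g) - {0}. b (Suc g) j) =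
        expansion_coeff (Suc g) 0 + (\<Sum>j\<in>index_range (Suc g) - {0}. expansion_coeff (Suc g) j)"
      by (simp only: sum.remove[OF finite_index_range zero_in_index_range])
    moreover have "(\<Sum>j\<in>index_range (Suc g) - {0}. b (Suc g) j) =
        (\<Sum>j\<in>index_range (Suc g) - {0}. expansion_coeff (Suc g) j)"
      by (intro sum.cong refl nz) auto
    ultimately show ?case using nz by (cases "k = 0") simp_all
  qed
  then show ?thesis by blast
qed

lemma v_linearly_independent:
  assumes "\<And>l. l > 0 \<Longrightarrow> (\<Sum>k\<in>index_range g. d k * v k l) = 0" and "k \<in> index_range g"
  shows "d k = 0"
proof -
  \<comment> \<open>Multiplying \<open>v k\<close> by \<open>u^(6g)\<close> makes every exponent a
    natural number, so the relation becomes a polynomial vanishing on the interval from 0 to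
    1.\<close>
  define e where "e k = nat (2 * (k + 3 * int g) + 1)" for k
  define p where "p = (\<Sum>k\<in>index_range g. monom (d k) (e k))"
  have "poly p u = 0" if u: "0 < u" "u < 1" for u
  proof -
    \<comment> \<open>The inverse of the substitution
      \<open>u = (exp l - 1) / (exp l + 1)\<close>.\<close>
    define l where "l = ln ((1 + u) / (1 - u))"
    have "l > 0" using u by (auto simp: l_def)
    have exp_l: "exp l = (1 + u) / (1 - u)" using u by (simp add: l_def)
    have u_eq: "(exp l - 1) / (exp l + 1) = u"
      unfolding exp_l using u by (simp add: divide_simps)
    have "u ^ e j = u ^ (6 * g) * v j l" if "j \<in> index_range g" for j
    proof -
      have "int (e j) = int (6 * g) + (2 * j + 1)" using that by (simp add: e_def index_range_def)
      then have "u powi int (e j) = u powi int (6 * g) * u powi (2 * j + 1)"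
        using power_int_add[of u "int (6 * g)" "2 * j + 1"] u by (simp only:) simp
      then show ?thesis by (simp add: v_def u_eq del: of_nat_mult)
    qed
    then have "poly p u = (\<Sum>k\<in>index_range g. u ^ (6 * g) * (d k * v k l))"
      unfolding p_def poly_sum poly_monom by (intro sum.cong refl) simp
    also have "\<dots> = 0"
      unfolding sum_distrib_left[symmetric] assms(1)[OF \<open>l > 0\<close>] by simp
    finally show ?thesis .
  qed
  then have "{0<..<1} \<subseteq> {t. poly p t = 0}" by auto
  moreover have "infinite {0 :: real<..<1}" by (simp add: infinite_Ioo)
  ultimately have "p = 0" using poly_roots_finite[of p] finite_subset by blast
  have "coeff p (e k) = (\<Sum>j\<in>index_range g. if j = k then d j else 0)"
    unfolding p_def coeff_sum using assms(2)
    by (intro sum.cong refl) (auto simp: e_def index_range_def)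
  then show ?thesis using assms(2) \<open>p = 0\<close> by simp
qed

lemma is_W1_expansion_unique:
  assumes "is_W1_expansion a" "is_W1_expansion b"
  shows "b = a"
proof (intro ext)
  fix g k
  show "b g k = a g k"
  proof (cases "k \<in> index_range g")
    case True
    have "(\<Sum>k\<in>index_range g. (b g k - a g k) * v k l) = 0" if "l > 0" for l
      using assms that
      by (cases "g = 0") (auto simp: is_W1_expansion_def left_diff_distrib sum_subtractf)
    from v_linearly_independent[OF this True] show ?thesis by simp
  next
    case False
    then show ?thesis using assms by (simp add: is_W1_expansion_def zero_outside_range_def)
  qed
qed

text \<open>As \<lambda> grows, \<open>u\<close> tends to 1 and so does every \<open>v k\<close>;
  the limit is therefore the sum of the coefficients.\<close>

lemma W1_tendsto_0:
  assumes "g \<ge> 1"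
  shows "((\<lambda>l. W1 g (x_of l)) \<longlongrightarrow> 0) at_top"
proof -
  have "((\<lambda>l::real. (exp l - 1) / (exp l + 1)) \<longlongrightarrow> 1) at_top"
    by real_asymp
  then have "((\<lambda>l. \<Sum>k\<in>index_range g. expansion_coeff g k * v k l) \<longlongrightarrow>
      (\<Sum>k\<in>index_range g. expansion_coeff g k * 1 powi (2 * k + 1))) at_top"
    unfolding v_def by (intro tendsto_intros) auto
  moreover have "(\<Sum>k\<in>index_range g. expansion_coeff g k) = 0"
    using assms sum_expansion_coeff by (cases g) auto
  ultimately have "((\<lambda>l. \<Sum>k\<in>index_range g. expansion_coeff g k * v k l) \<longlongrightarrow> 0) at_top"
    by simp
  moreover have "\<forall>\<^sub>F l in at_top. (\<Sum>k\<in>index_range g. expansion_coeff g k * v k l) = W1 g (x_of l)"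
    using eventually_gt_at_top[of 0]
    by eventually_elim (use is_W1_expansion_expansion_coeff assms in \<open>simp add: is_W1_expansion_def\<close>)
  ultimately show ?thesis by (rule Lim_transform_eventually)
qed

theorem lemma2:
  shows "(\<forall>g. \<forall>l>0. summable (W1_term g (x_of l))) \<and>
    (\<exists>a. is_W1_expansion a \<and> satisfies_recursion a \<and>
      (\<forall>b. is_W1_expansion b \<longrightarrow> b = a) \<and>
      (\<forall>b. satisfies_recursion b \<longrightarrow> b = a)) \<and>
    (\<forall>g\<ge>1. ((\<lambda>l. W1 g (x_of l)) \<longlongrightarrow> 0) at_top)"
proof (intro conjI)
  show "\<forall>g. \<forall>l>0. summable (W1_term g (x_of l))"
    using W1_term_sums sums_summable by blast
  show "\<exists>a. is_W1_expansion a \<and> satisfies_recursion a \<and>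
      (\<forall>b. is_W1_expansion b \<longrightarrow> b = a) \<and> (\<forall>b. satisfies_recursion b \<longrightarrow> b = a)"
    using is_W1_expansion_expansion_coeff satisfies_recursion_expansion_coeff
      is_W1_expansion_unique satisfies_recursion_unique by blast
  show "\<forall>g\<ge>1. ((\<lambda>l. W1 g (x_of l)) \<longlongrightarrow> 0) at_top"
    using W1_tendsto_0 by blast
qed

end
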